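(* Let $\Omega\subset\mathbb{C}$ be a bounded John domain and let $1<p<\infty$. For an integer $m\ge1$, say that the order-$m$ comparison holds if for every $z_0\in\Omega$ there is a constant $C\ge1$ such that every analytic function $f$ in $\Omega$ satisfies $$ C^{-1}\int_\Omega |f^{(m)}(z)|^p\delta(z)^{mp-2}\,dA(z) \le |f^{(m)}(z_0)|^p\delta(z_0)^{mp}+\int_\Omega |f^{(m+1)}(z)|^p\delta(z)^{(m+1)p-2}\,dA(z) \le C\int_\Omega |f^{(m)}(z)|^p\delta(z)^{mp-2}\,dA(z). $$ Then the following assertions hold. (i) For every integer $m\ge2$, the order-$m$ comparison holds (without any additional assumption on $\partial\Omega$). (ii) For $m=1$, the order-$1$ comparison holds whenever $2\le p<\infty$. (iii) For $m=1$ and $1<p<2$, the order-$1$ comparison holds if $\dim_{\mathrm A}(\partial\Omega)<p$.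
   Context: $\delta(z)=\operatorname{dist}(z,\partial\Omega)$ is the Euclidean distance to the boundary and $dA=dx\,dy$ is Euclidean area measure. A domain is a nonempty connected open set. Inequalities involving possibly infinite integrals are understood in the extended sense (values in $[0,\infty]$). $f^{(k)}$ denotes the $k$-th complex derivative. John domain: a bounded domain $\Omega\subset\mathbb{C}$ is a John domain if there exist a point $x_0\in\Omega$ and a constant $C_J>0$ such that every $x\in\Omega$ can be joined to $x_0$ by a rectifiable curve $\gamma:[0,\ell]\to\Omega$, parametrized by arclength starting from $x$ (so $\gamma(0)=x$, $\gamma(\ell)=x_0$), with $\delta(\gamma(t))\ge C_J t$ for $0\le t\le \ell$. Assouad dimension: for $E\subset\mathbb{C}$, $\dim_{\mathrm A}(E)$ is the infimum of all exponents $s\ge0$ for which there is a constant $C>0$ such that $N_r(E\cap B(x,R))\le C(R/r)^s$ for all $x\in E$ and all $0<r<R$, where $B(x,R)$ is the open ball and $N_r(A)$ is the smallest number of open balls of radius $r$ needed to cover $A$. *)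

theory Defs
  imports "HOL-Analysis.Analysis"
begin

definition bdist :: "complex set \<Rightarrow> complex \<Rightarrow> real" where
  "bdist \<Omega> z = infdist z (frontier \<Omega>)"

(* The supremum over finite partitions. The partition points need not include a and b:
   by the triangle inequality adding them only increases the sum. *)
definition curve_length :: "(real \<Rightarrow> complex) \<Rightarrow> real \<Rightarrow> real \<Rightarrow> ennreal" where
  "curve_length \<gamma> a b =
     (SUP ts \<in> {ts. sorted ts \<and> set ts \<subseteq> {a..b}}.
        \<Sum>i<length ts - 1. ennreal (dist (\<gamma> (ts ! i)) (\<gamma> (ts ! Suc i))))"

(* Rectifiability is part of this: the total length is the finite number l.
   The degenerate case l = 0 is the constant curve. *)
definition arclength_curve :: "(real \<Rightarrow> complex) \<Rightarrow> real \<Rightarrow> bool" where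
  "arclength_curve \<gamma> l \<longleftrightarrow>
     0 \<le> l \<and> continuous_on {0..l} \<gamma> \<and> (\<forall>t\<in>{0..l}. curve_length \<gamma> 0 t = ennreal t)"

definition john_domain :: "complex set \<Rightarrow> bool" where
  "john_domain \<Omega> \<longleftrightarrow>
     open \<Omega> \<and> connected \<Omega> \<and> \<Omega> \<noteq> {} \<and> bounded \<Omega> \<and>
     (\<exists>x0\<in>\<Omega>. \<exists>CJ>0. \<forall>x\<in>\<Omega>. \<exists>\<gamma> l.
        arclength_curve \<gamma> l \<and> \<gamma> ` {0..l} \<subseteq> \<Omega> \<and> \<gamma> 0 = x \<and> \<gamma> l = x0 \<and>
        (\<forall>t\<in>{0..l}. bdist \<Omega> (\<gamma> t) \<ge> CJ * t))"

(* The centres of the covering balls may lie outside A; the value is \<infinity> if no finite cover exists. *)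
definition covering_number :: "real \<Rightarrow> complex set \<Rightarrow> enat" where
  "covering_number r A =
     (INF T \<in> {T. finite T \<and> A \<subseteq> (\<Union>c\<in>T. ball c r)}. enat (card T))"

definition assouad_dim :: "complex set \<Rightarrow> ereal" where
  "assouad_dim E =
     Inf (ereal ` {s. 0 \<le> s \<and>
       (\<exists>C>0. \<forall>x\<in>E. \<forall>R r. 0 < r \<and> r < R \<longrightarrow>
          ereal_of_enat (covering_number r (E \<inter> ball x R)) \<le> ereal (C * (R / r) powr s))})"

definition weighted_integral :: "complex set \<Rightarrow> real \<Rightarrow> nat \<Rightarrow> (complex \<Rightarrow> complex) \<Rightarrow> ennreal" where
  "weighted_integral \<Omega> p k f =
     (\<integral>\<^sup>+z\<in>\<Omega>. ennreal (norm ((deriv ^^ k) f z) powr p * bdist \<Omega> z powr (real k * p - 2)) \<partial>lborel)"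

definition order_comparison :: "complex set \<Rightarrow> real \<Rightarrow> nat \<Rightarrow> bool" where
  "order_comparison \<Omega> p m \<longleftrightarrow>
     (\<forall>z0\<in>\<Omega>. \<exists>C::real. C \<ge> 1 \<and> (\<forall>f. f analytic_on \<Omega> \<longrightarrow>
        (let M = ennreal (norm ((deriv ^^ m) f z0) powr p * bdist \<Omega> z0 powr (real m * p))
                 + weighted_integral \<Omega> p (m + 1) f
         in ennreal (inverse C) * weighted_integral \<Omega> p m f \<le> M \<and>
            M \<le> ennreal C * weighted_integral \<Omega> p m f)))"

end

theory Submission
  imports Defs "HOL-Complex_Analysis.Complex_Analysis"
begin

text \<open>
  Put \<open>g = f\<^sup>(\<^sup>m\<^sup>)\<close> and \<open>a = mp - 2\<close>. The upper bound follows from Cauchy's estimate, the sub-mean value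
  property of \<open>|g|\<^sup>p\<close> on discs of radius comparable to \<open>\<delta>\<close>, and Fubini's theorem.

  For the lower bound, let \<open>h = min |g| N\<close>. On a disc of radius comparable to \<open>\<delta>\<close>, Young's inequality
  bounds the oscillation of \<open>h\<^sup>p\<close> by the mean of \<open>F = \<epsilon> h\<^sup>p + C\<^sub>\<epsilon> |g'|\<^sup>p \<delta>\<^sup>p\<close>. Adding this up along the John
  curve from \<open>z\<close> to \<open>x\<^sub>0\<close>, which spends a time at most \<open>C \<delta>(w)\<close> near each \<open>w\<close>, gives
  \<open>h(z)\<^sup>p \<le> h(x\<^sub>0)\<^sup>p + C \<integral> \<delta>(w)\<^sup>-\<^sup>2 F(w) dA(w)\<close>, the integral being over the \<open>w\<close> with \<open>|z - w| < K \<delta>(w)\<close>.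
  Multiply by \<open>\<delta>(z)\<^sup>a\<close> and integrate. By Fubini's theorem, the estimate
  \<open>\<integral> \<delta>(z)\<^sup>a dA(z) \<le> C \<delta>(w)\<^sup>a\<^sup>+\<^sup>2\<close> over \<open>|z - w| < K \<delta>(w)\<close> turns the right-hand side into
  \<open>C (h(x\<^sub>0)\<^sup>p + \<integral> F \<delta>\<^sup>a)\<close>, where the \<open>\<epsilon>\<close>-term is absorbed; then let \<open>N \<rightarrow> \<infinity>\<close>. The estimate is trivial for
  \<open>a \<ge> 0\<close>, and for \<open>a < 0\<close> it follows from the Assouad dimension of the boundary being less than \<open>a + 2\<close>.
\<close>

subsection \<open>Preliminaries\<close>

text \<open>The constant is not sharp. At a maximum point \<open>u\<close> of \<open>|g(w)| (r - |w - z|)\<^sup>2\<close>, Cauchy's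
  estimate shows that \<open>|g|\<close> stays above \<open>|g(u)| / 2\<close> on a disc around \<open>u\<close> whose radius is comparable
  to the distance from \<open>u\<close> to the circle. This avoids polar coordinates and Jensen's inequality.\<close>

lemma powr_submean_value:
  fixes g :: "complex \<Rightarrow> complex"
  assumes "open S" "g holomorphic_on S" "cball z r \<subseteq> S" "0 < r" "1 \<le> p"
  shows "ennreal (norm (g z) powr p * (pi * r\<^sup>2))
           \<le> ennreal (1024 * 2 powr p) * (\<integral>\<^sup>+w\<in>ball z r. ennreal (norm (g w) powr p) \<partial>lborel)"
proof -
  define \<Psi> where "\<Psi> w = norm (g w) * (r - dist z w)\<^sup>2" for w
  have contg: "continuous_on (cball z r) g"
    using assms holomorphic_on_imp_continuous_on continuous_on_subset by blast
  have "continuous_on (cball z r) \<Psi>"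
    unfolding \<Psi>_def by (intro continuous_intros contg)
  then obtain u where u: "u \<in> cball z r" and umax: "\<And>w. w \<in> cball z r \<Longrightarrow> \<Psi> w \<le> \<Psi> u"
    using continuous_attains_sup[of "cball z r" \<Psi>] \<open>0 < r\<close> by auto
  show ?thesis
  proof (cases "g z = 0")
    case True
    then show ?thesis by simp
  next
    case False
    have \<Psi>z: "norm (g z) * r\<^sup>2 \<le> \<Psi> u"
      using umax[of z] \<open>0 < r\<close> by (simp add: \<Psi>_def)
    have "0 < norm (g z) * r\<^sup>2" using False \<open>0 < r\<close> by simp
    with \<Psi>z have "0 < \<Psi> u" by linarith
    \<comment> \<open>Half the distance from \<open>u\<close> to the circle: on
      \<open>cball u \<rho>\<close> the factor \<open>r - dist z w\<close> is still at least
      \<open>\<rho>\<close>, against \<open>2 * \<rho>\<close> at \<open>u\<close>, so maximality of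
      \<open>u\<close> costs only a factor 4.\<close>
    define \<rho> where "\<rho> = (r - dist z u) / 2"
    have "r - dist z u \<noteq> 0" using \<open>0 < \<Psi> u\<close> by (auto simp: \<Psi>_def)
    then have "0 < \<rho>" using u by (simp add: \<rho>_def)
    have "2 * \<rho> = r - dist z u" by (simp add: \<rho>_def)
    then have gu: "\<Psi> u = norm (g u) * (2 * \<rho>)\<^sup>2" by (simp only: \<Psi>_def)
    have "0 < norm (g u)" using \<open>0 < \<Psi> u\<close> gu by (auto simp: zero_less_mult_iff)
    have dist_z: "dist z w \<le> r - \<rho>" if "dist u w \<le> \<rho>" for w
      using that dist_triangle[of z w u] by (simp add: \<rho>_def field_simps)
    have bound4: "norm (g w) \<le> 4 * norm (g u)" if "dist u w \<le> \<rho>" for w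
    proof -
      have "\<rho>\<^sup>2 \<le> (r - dist z w)\<^sup>2"
        using dist_z[OF that] \<open>0 < \<rho>\<close> by (intro power_mono) auto
      then have "norm (g w) * \<rho>\<^sup>2 \<le> \<Psi> w"
        unfolding \<Psi>_def by (intro mult_left_mono) auto
      also have "\<dots> \<le> \<Psi> u"
        using dist_z[OF that] \<open>0 < \<rho>\<close> by (intro umax) auto
      finally have "norm (g w) * \<rho>\<^sup>2 \<le> (4 * norm (g u)) * \<rho>\<^sup>2"
        by (simp add: gu power_mult_distrib mult_ac)
      then show ?thesis using \<open>0 < \<rho>\<close> by simp
    qed
    have "cball u \<rho> \<subseteq> cball z r"
      using dist_z \<open>0 < \<rho>\<close> by force
    with assms(3) have sub: "cball u \<rho> \<subseteq> S" by blast
    have derb: "norm (deriv g w) \<le> 8 * norm (g u) / \<rho>" if "dist u w < \<rho> / 2" for w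
    proof -
      have in_u: "dist u v \<le> \<rho>" if "dist w v \<le> \<rho> / 2" for v
        using that \<open>dist u w < \<rho> / 2\<close> dist_triangle[of u v w] by linarith
      then have "cball w (\<rho> / 2) \<subseteq> S"
        using sub by (auto simp: subset_iff)
      then have hol: "g holomorphic_on cball w (\<rho> / 2)"
        using assms holomorphic_on_subset by blast
      have "norm ((deriv ^^ 1) g w) \<le> fact 1 * (4 * norm (g u)) / (\<rho> / 2) ^ 1"
      proof (rule Cauchy_inequality)
        show "norm (g v) \<le> 4 * norm (g u)" if "norm (w - v) = \<rho> / 2" for v
          using that by (intro bound4 in_u) (simp add: dist_norm)
      qed (use hol \<open>0 < \<rho>\<close> in \<open>auto intro: holomorphic_on_subset holomorphic_on_imp_continuous_on\<close>)
      then show ?thesis by simp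
    qed
    \<comment> \<open>The factor 8 in the derivative bound comes from the bound 4 on a circle of
      radius \<open>\<rho> / 2\<close>. Over a distance \<open>\<rho> / 16\<close> it allows a
      change of at most half of \<open>norm (g u)\<close>.\<close>
    have half: "norm (g u) / 2 \<le> norm (g w)" if "dist u w < \<rho> / 16" for w
    proof -
      have "norm (g w - g u) \<le> 8 * norm (g u) / \<rho> * norm (w - u)"
      proof (rule field_differentiable_bound)
        show "convex (ball u (\<rho> / 2))" by simp
        show "(g has_field_derivative deriv g v) (at v within ball u (\<rho> / 2))"
          if "v \<in> ball u (\<rho> / 2)" for v
          using that sub assms \<open>0 < \<rho>\<close>
          by (intro DERIV_subset[OF holomorphic_derivI[of g S]]) (auto simp: subset_iff)
        show "norm (deriv g v) \<le> 8 * norm (g u) / \<rho>" if "v \<in> ball u (\<rho> / 2)" for v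
          using derb that by simp
      qed (use that \<open>0 < \<rho>\<close> in \<open>simp_all add: dist_norm\<close>)
      also have "\<dots> \<le> 8 * norm (g u) / \<rho> * (\<rho> / 16)"
        using that \<open>0 < \<rho>\<close> by (intro mult_left_mono) (auto simp: dist_norm norm_minus_commute)
      also have "\<dots> = norm (g u) / 2" using \<open>0 < \<rho>\<close> by simp
      finally show ?thesis using norm_triangle_ineq2[of "g u" "g w"] by (simp add: norm_minus_commute)
    qed
    have x1: "(2 * \<rho> / r) \<le> 1" "0 < 2 * \<rho> / r"
      using \<open>0 < \<rho>\<close> \<open>0 < r\<close> by (auto simp: \<rho>_def field_simps)
    have "norm (g z) \<le> norm (g u) * (2 * \<rho> / r)\<^sup>2"
      using \<Psi>z \<open>0 < r\<close> by (simp add: gu field_simps)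
    then have "norm (g z) powr p \<le> (norm (g u) * (2 * \<rho> / r)\<^sup>2) powr p"
      using assms by (intro powr_mono2) auto
    also have "\<dots> = norm (g u) powr p * (2 * \<rho> / r)\<^sup>2 powr p"
      by (rule powr_mult)
    \<comment> \<open>The base is at most 1 and \<open>1 \<le> p\<close>, so the exponent may be
      lowered to 1. The remaining quotient of squared radii turns the area
      \<open>pi * r\<^sup>2\<close> into a multiple of the area of the small disc; 1024 is
      \<open>4 * 16\<^sup>2\<close>.\<close>
    also have "\<dots> \<le> norm (g u) powr p * (2 * \<rho> / r)\<^sup>2 powr 1"
      using assms x1 by (intro mult_left_mono powr_mono_both')
        (auto simp: power_le_one)
    also have "\<dots> = norm (g u) powr p * (4 * \<rho>\<^sup>2 / r\<^sup>2)"
      by (simp add: power_mult_distrib power_divide)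
    finally have "norm (g z) powr p * (pi * r\<^sup>2) \<le> norm (g u) powr p * (4 * \<rho>\<^sup>2 / r\<^sup>2) * (pi * r\<^sup>2)"
      by (intro mult_right_mono) auto
    also have "\<dots> = (1024 * 2 powr p) * ((norm (g u) / 2) powr p * (pi * (\<rho> / 16)\<^sup>2))"
      using \<open>0 < r\<close> by (simp add: powr_divide field_simps power_divide)
    finally have "ennreal (norm (g z) powr p * (pi * r\<^sup>2))
        \<le> ennreal ((1024 * 2 powr p) * ((norm (g u) / 2) powr p * (pi * (\<rho> / 16)\<^sup>2)))"
      by (rule ennreal_leI)
    also have "\<dots> = ennreal (1024 * 2 powr p) *
        (\<integral>\<^sup>+w\<in>ball u (\<rho> / 16). ennreal ((norm (g u) / 2) powr p) \<partial>lborel)"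
      using \<open>0 < \<rho>\<close>
      by (subst nn_integral_cmult_indicator)
         (auto simp: emeasure_ball unit_ball_vol_2 ennreal_mult)
    also have "\<dots> \<le> ennreal (1024 * 2 powr p) * (\<integral>\<^sup>+w\<in>ball z r. ennreal (norm (g w) powr p) \<partial>lborel)"
    proof (intro mult_left_mono nn_integral_mono)
      fix w
      have "dist z w < r" if "dist u w < \<rho> / 16"
        using dist_z[of w] that \<open>0 < \<rho>\<close> by linarith
      then show "ennreal ((norm (g u) / 2) powr p) * indicator (ball u (\<rho> / 16)) w
          \<le> ennreal (norm (g w) powr p) * indicator (ball z r) w"
        using half[of w] assms by (auto simp: indicator_def intro!: ennreal_leI powr_mono2)
    qed simp
    finally show ?thesis .
  qed
qed

text \<open>Any partition of \<open>{0..s}\<close> can be prolonged by the points \<open>s\<close>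
  and \<open>t\<close>, so the length up to \<open>t\<close> exceeds the length up to
  \<open>s\<close> by at least the chord.\<close>

lemma arclength_curve_lipschitz:
  assumes "arclength_curve \<gamma> l" "0 \<le> s" "s \<le> t" "t \<le> l"
  shows "dist (\<gamma> s) (\<gamma> t) \<le> t - s"
proof -
  let ?d = "dist (\<gamma> s) (\<gamma> t)"
  let ?P = "\<lambda>t. {ts. sorted ts \<and> set ts \<subseteq> {0..t}}"
  let ?L = "\<lambda>ts. \<Sum>i<length ts - 1. ennreal (dist (\<gamma> (ts ! i)) (\<gamma> (ts ! Suc i)))"
  have len: "curve_length \<gamma> 0 u = ennreal u" if "u \<in> {0..l}" for u
    using assms(1) that by (simp add: arclength_curve_def)
  have ext: "?L ts + ennreal ?d \<le> ennreal t" if "ts \<in> ?P s" for ts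
  proof -
    let ?ts = "ts @ [s, t]"
    have mem: "?ts \<in> ?P t"
      using that assms by (auto simp: sorted_append)
    \<comment> \<open>Index \<open>length ts\<close> is the jump from \<open>s\<close> to
      \<open>t\<close>. The jump from the last point of \<open>ts\<close> to \<open>s\<close>, at
      index \<open>length ts - 1\<close>, is discarded.\<close>
    have "?L ts + ennreal ?d = (\<Sum>i\<in>insert (length ts) {..<length ts - 1}.
        ennreal (dist (\<gamma> (?ts ! i)) (\<gamma> (?ts ! Suc i))))"
      by (subst sum.insert) (auto simp: nth_append add.commute simp del: sum_ennreal intro!: sum.cong)
    also have "\<dots> \<le> ?L ?ts"
      by (intro sum_mono2) auto
    also have "\<dots> \<le> curve_length \<gamma> 0 t"
      unfolding curve_length_def using mem by (intro SUP_upper)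
    also have "\<dots> = ennreal t" using assms by (intro len) auto
    finally show ?thesis .
  qed
  have "?P s \<noteq> {}" by (auto intro: exI[of _ "[]"])
  have "ennreal s + ennreal ?d = (SUP ts\<in>?P s. ?L ts) + ennreal ?d"
    using len[of s] assms by (simp add: curve_length_def)
  also have "\<dots> = (SUP ts\<in>?P s. ?L ts + ennreal ?d)"
    using \<open>?P s \<noteq> {}\<close> by (rule ennreal_SUP_add_left[symmetric])
  also have "\<dots> \<le> ennreal t" using ext by (rule SUP_least)
  finally have "ennreal (s + ?d) \<le> ennreal t" using assms by (subst ennreal_plus) auto
  then show ?thesis using assms by (subst (asm) ennreal_le_iff) auto
qed

section \<open>Real powers, absorption and coverings\<close>

text \<open>A form of Young's inequality: the left side is the mean value bound for the increase of
  \<open>u powr p\<close> from \<open>h\<close> to \<open>h + S\<close>. If \<open>S\<close> is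
  small relative to \<open>h\<close>, the product is at most \<open>e * h powr p\<close>; otherwise
  \<open>h\<close> is dominated by a multiple of \<open>S\<close> and everything goes into
  \<open>C * S powr p\<close>.\<close>

lemma powr_absorb:
  fixes e p :: real
  assumes "0 < e" "1 \<le> p"
  obtains C where "0 < C" "\<And>S h. 0 \<le> S \<Longrightarrow> 0 \<le> h \<Longrightarrow> p * S * (h + S) powr (p - 1) \<le> e * h powr p + C * S powr p"
proof -
  define \<eta> where "\<eta> = min 1 (e / (p * 2 powr (p - 1)))"
  have \<eta>: "0 < \<eta>" "\<eta> \<le> 1" "p * \<eta> * 2 powr (p - 1) \<le> e"
    using assms by (auto simp: \<eta>_def min_def field_simps)
  define C where "C = p * (1 / \<eta> + 1) powr (p - 1)"
  have "1 / \<eta> + 1 \<noteq> 0" using \<eta> by (smt (verit) divide_pos_pos)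
  then have "0 < C" using assms by (simp add: C_def)
  moreover have "p * S * (h + S) powr (p - 1) \<le> e * h powr p + C * S powr p"
    if "0 \<le> S" "0 \<le> h" for S h
  proof (cases "S \<le> \<eta> * h")
    case True
    have "S \<le> h" using True \<eta> that by (smt (verit) mult_left_le_one_le)
    have "p * S * (h + S) powr (p - 1) \<le> p * (\<eta> * h) * (2 * h) powr (p - 1)"
      using True \<open>S \<le> h\<close> that assms \<eta> by (intro mult_mono powr_mono2) auto
    also have "\<dots> = (p * \<eta> * 2 powr (p - 1)) * h powr p"
      using that by (cases "h = 0") (auto simp: powr_mult powr_diff field_simps)
    also have "\<dots> \<le> e * h powr p" using \<eta> by (intro mult_right_mono) auto
    finally show ?thesis using \<open>0 < C\<close> by (smt (verit) mult_nonneg_nonneg powr_ge_zero)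
  next
    case False
    then have "h \<le> S / \<eta>" using \<eta> by (simp add: field_simps)
    have "p * S * (h + S) powr (p - 1) \<le> p * S * (S / \<eta> + S) powr (p - 1)"
      using \<open>h \<le> S / \<eta>\<close> that assms by (intro mult_left_mono powr_mono2) auto
    also have "S / \<eta> + S = (1 / \<eta> + 1) * S" by (simp add: field_simps)
    also have "p * S * ((1 / \<eta> + 1) * S) powr (p - 1) = C * S powr p"
      using that \<eta> by (cases "S = 0") (auto simp: C_def powr_mult powr_diff)
    finally show ?thesis using assms by (smt (verit) mult_nonneg_nonneg powr_ge_zero)
  qed
  ultimately show thesis by (rule that)
qed

lemma powr_diff_le:
  fixes x y p :: real
  assumes "0 \<le> x" "0 \<le> y" "1 \<le> p" "x \<le> M" "y \<le> M"
  shows "\<bar>x powr p - y powr p\<bar> \<le> p * \<bar>x - y\<bar> * M powr (p - 1)"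
proof -
  have *: "b powr p - a powr p \<le> p * (b - a) * M powr (p - 1)" if ab: "0 \<le> a" "a < b" "b \<le> M" for a b
  proof -
    have cont: "continuous_on {a..b} (\<lambda>u. u powr p)"
      using ab assms by (intro continuous_on_powr' continuous_intros) auto
    have der: "((\<lambda>u. u powr p) has_real_derivative p * u powr (p - 1)) (at u)" if "a < u" for u
      using that ab by (intro has_real_derivative_powr) auto
    obtain D c where c: "a < c" "c < b" "((\<lambda>u. u powr p) has_real_derivative D) (at c)"
        "b powr p - a powr p = (b - a) * D"
      using MVT[OF \<open>a < b\<close> cont] der real_differentiable_def by blast
    have "D = p * c powr (p - 1)" using c(3) der[OF c(1)] by (rule DERIV_unique)
    also have "\<dots> \<le> p * M powr (p - 1)"
      using c ab assms by (intro mult_left_mono powr_mono2) auto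
    finally have "(b - a) * D \<le> (b - a) * (p * M powr (p - 1))" using ab by (intro mult_left_mono) auto
    then show ?thesis using c by (simp add: mult_ac)
  qed
  consider "x = y" | "x < y" | "y < x" by linarith
  then show ?thesis
  proof cases
    case 2
    then show ?thesis using *[of x y] assms powr_mono2[of p x y] by (simp add: abs_if)
  next
    case 3
    then show ?thesis using *[of y x] assms powr_mono2[of p y x] by (simp add: abs_if)
  qed simp
qed

lemma borel_measurable_lipschitz:
  fixes \<gamma> :: "real \<Rightarrow> 'a::metric_space"
  assumes "\<And>s t. dist (\<gamma> s) (\<gamma> t) \<le> \<bar>s - t\<bar>"
  shows "\<gamma> \<in> borel_measurable borel"
proof (intro borel_measurable_continuous_onI lipschitz_on_continuous_on)
  show "1-lipschitz_on UNIV \<gamma>"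
    using assms by (intro lipschitz_onI) (auto simp: dist_real_def)
qed

text \<open>Finiteness of \<open>X\<close> is what allows half of it to be subtracted from both
  sides; in the application truncation provides it.\<close>

lemma ennreal_absorb_half:
  fixes X A :: ennreal
  assumes "X \<le> A + ennreal (1 / 2) * X" "X < top"
  shows "X \<le> 2 * A"
proof (cases A)
  case (real a)
  obtain x where x: "X = ennreal x" "0 \<le> x" using assms(2) by (cases X) auto
  have "ennreal (a + 1 / 2 * x) = ennreal a + ennreal (1 / 2) * ennreal x"
    using real x by (subst ennreal_plus, simp, simp, subst ennreal_mult, auto)
  then have "ennreal x \<le> ennreal (a + 1 / 2 * x)"
    using assms(1) real x by simp
  then have "x \<le> 2 * a" using x real by (subst (asm) ennreal_le_iff) auto
  then have "ennreal x \<le> ennreal (2 * a)" by (rule ennreal_leI)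
  then show ?thesis using x real by (simp add: ennreal_mult)
next
  case top
  then show ?thesis by (simp add: ennreal_mult_top)
qed

text \<open>The absolute value treats both signs of the exponent at once. The lemma serves to trade
  powers of \<open>\<delta>\<close> at one point of a small disc for powers at its centre.\<close>

lemma powr_comparable:
  fixes x y b :: real
  assumes "0 < x" "0 < y" "x \<le> 2 * y" "y \<le> 2 * x"
  shows "y powr b \<le> 2 powr \<bar>b\<bar> * x powr b"
proof (cases "0 \<le> b")
  case True
  have "y powr b \<le> (2 * x) powr b" using assms True by (intro powr_mono2) auto
  also have "\<dots> = 2 powr b * x powr b" by (rule powr_mult)
  finally show ?thesis using True by simp
next
  case False
  have "y powr b \<le> (x / 2) powr b" using assms False by (intro powr_mono2') auto
  also have "\<dots> = x powr b / 2 powr b" by (rule powr_divide)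
  finally show ?thesis using False by (simp add: powr_minus_divide)
qed

text \<open>A real bound excludes the value infinity, which is the infimum of the empty set, and the
  infimum of a nonempty set of extended naturals is attained.\<close>

lemma covering_number_le_obtains:
  assumes "ereal_of_enat (covering_number r A) \<le> ereal y"
  obtains T where "finite T" "A \<subseteq> (\<Union>c\<in>T. ball c r)" "real (card T) \<le> y"
proof -
  let ?S = "(\<lambda>T. enat (card T)) ` {T. finite T \<and> A \<subseteq> (\<Union>c\<in>T. ball c r)}"
  have "?S \<noteq> {}"
  proof
    assume "?S = {}"
    then have "covering_number r A = \<infinity>"
      by (simp only: covering_number_def Inf_enat_def simp_thms if_True)
    then show False using assms by simp
  qed
  then have "covering_number r A \<in> ?S"
    unfolding covering_number_def by (auto simp: Inf_enat_def intro: LeastI)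
  then obtain T where T: "finite T" "A \<subseteq> (\<Union>c\<in>T. ball c r)" "covering_number r A = enat (card T)"
    by blast
  then show thesis using assms that by simp
qed

lemma emeasure_Union_balls_le:
  fixes T :: "complex set"
  assumes "finite T" "0 \<le> r"
  shows "emeasure lborel (\<Union>c\<in>T. ball c r) \<le> ennreal (real (card T) * (pi * r\<^sup>2))"
proof -
  have "emeasure lborel (\<Union>c\<in>T. ball c r) \<le> (\<Sum>c\<in>T. emeasure lborel (ball c r))"
    using assms by (intro emeasure_subadditive_finite) auto
  also have "\<dots> = (\<Sum>c\<in>T. ennreal (pi * r\<^sup>2))"
    using assms by (intro sum.cong) (auto simp: emeasure_ball unit_ball_vol_2)
  also have "\<dots> = ennreal (real (card T) * (pi * r\<^sup>2))"
    by (simp add: ennreal_mult ennreal_of_nat_eq_real_of_nat)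
  finally show ?thesis .
qed

subsection \<open>Oscillation along John curves\<close>

text \<open>Boundedness and non-emptiness exclude an empty frontier, for which
  \<open>infdist\<close> would take the default value 0. Connectedness and the John curves are
  supplied as hypotheses where they are needed.\<close>

locale bounded_open_set =
  fixes \<Omega> :: "complex set"
  assumes open_\<Omega>: "open \<Omega>" and bounded_\<Omega>: "bounded \<Omega>" and nonempty_\<Omega>: "\<Omega> \<noteq> {}"
begin

abbreviation \<delta> :: "complex \<Rightarrow> real" where "\<delta> \<equiv> bdist \<Omega>"

lemma frontier_nonempty: "frontier \<Omega> \<noteq> {}"
  using bounded_\<Omega> nonempty_\<Omega> not_bounded_UNIV by (auto simp: frontier_eq_empty)

lemma \<delta>_pos: "z \<in> \<Omega> \<Longrightarrow> 0 < \<delta> z"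
  using open_\<Omega> frontier_nonempty
  by (auto simp: bdist_def frontier_def interior_open intro!: infdist_pos_not_in_closed)

lemma \<delta>_nonneg: "0 \<le> \<delta> z"
  by (simp add: bdist_def infdist_nonneg)

lemma \<delta>_lipschitz: "\<delta> z \<le> \<delta> w + dist z w"
  by (simp add: bdist_def infdist_triangle)

text \<open>A ball is connected, so if it left \<open>\<Omega>\<close> it would contain a frontier
  point closer to the centre than \<open>\<delta> z\<close>.\<close>

lemma ball_\<delta>_subset: "z \<in> \<Omega> \<Longrightarrow> ball z (\<delta> z) \<subseteq> \<Omega>"
proof (rule ccontr)
  assume "z \<in> \<Omega>" "\<not> ball z (\<delta> z) \<subseteq> \<Omega>"
  then have "z \<in> ball z (\<delta> z) \<inter> \<Omega>" "ball z (\<delta> z) - \<Omega> \<noteq> {}"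
    using \<delta>_pos[of z] by auto
  then have "ball z (\<delta> z) \<inter> frontier \<Omega> \<noteq> {}"
    by (intro connected_Int_frontier) blast+
  then obtain x where "dist z x < \<delta> z" "x \<in> frontier \<Omega>" by auto
  then show False using infdist_le[of x "frontier \<Omega>" z] by (simp add: bdist_def)
qed

lemma continuous_on_\<delta> [continuous_intros]:
  "continuous_on A f \<Longrightarrow> continuous_on A (\<lambda>x. \<delta> (f x))"
  unfolding bdist_def by (intro continuous_intros)

lemma measurable_\<delta> [measurable]: "\<delta> \<in> borel_measurable borel"
  by (intro borel_measurable_continuous_onI continuous_intros)

lemma sets_\<Omega> [measurable]: "\<Omega> \<in> sets borel"
  using open_\<Omega> by simp

lemma \<delta>_comparable:
  assumes "w \<in> \<Omega>" "dist w v < \<delta> w / 4"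
  shows "v \<in> \<Omega>" "\<delta> v \<le> 5 / 4 * \<delta> w" "\<delta> w \<le> 4 / 3 * \<delta> v"
proof -
  show "v \<in> \<Omega>" using ball_\<delta>_subset[OF assms(1)] \<delta>_pos[OF assms(1)] assms(2) by (auto simp: subset_iff)
  show "\<delta> v \<le> 5 / 4 * \<delta> w" "\<delta> w \<le> 4 / 3 * \<delta> v"
    using \<delta>_lipschitz[of v w] \<delta>_lipschitz[of w v] assms(2) by (auto simp: dist_commute)
qed

section \<open>Estimates on discs of radius comparable to the boundary distance\<close>

text \<open>\<open>S\<close> is \<open>\<delta> w\<close> times the maximum of
  \<open>norm (deriv g v)\<close> on the closed disc, attained at some \<open>u\<close>. The
  sub-mean value inequality for \<open>deriv g\<close> at \<open>u\<close>, on a disc of radius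
  \<open>\<delta> w / 8\<close> that stays within \<open>ball w (\<delta> w / 4)\<close>, bounds
  \<open>S powr p\<close> by an average.\<close>

lemma local_derivative_bound:
  fixes g :: "complex \<Rightarrow> complex"
  assumes g: "g holomorphic_on \<Omega>" and "1 \<le> p" and w: "w \<in> \<Omega>"
  obtains S where "0 \<le> S"
    "\<And>x y. x \<in> cball w (\<delta> w / 8) \<Longrightarrow> y \<in> cball w (\<delta> w / 8) \<Longrightarrow> norm (g x - g y) \<le> norm (x - y) * (S / \<delta> w)"
    "ennreal (S powr p) * ennreal (pi * (\<delta> w)\<^sup>2 / 64)
      \<le> (\<integral>\<^sup>+v\<in>ball w (\<delta> w / 4). ennreal (1024 * 4 powr p) * ennreal (norm (deriv g v) powr p * \<delta> v powr p) \<partial>lborel)"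
proof -
  define D where "D = \<delta> w"
  have "0 < D" using \<delta>_pos w by (simp add: D_def)
  have sub: "cball w (D / 8) \<subseteq> \<Omega>"
  proof
    fix v assume "v \<in> cball w (D / 8)"
    then show "v \<in> \<Omega>" using \<delta>_comparable(1)[OF w, of v] \<open>0 < D\<close> by (simp add: D_def)
  qed
  have holg': "deriv g holomorphic_on \<Omega>" using g open_\<Omega> by (rule holomorphic_deriv)
  have contg: "continuous_on \<Omega> g" and contg': "continuous_on \<Omega> (deriv g)"
    using g holg' holomorphic_on_imp_continuous_on by auto
  obtain u where u: "u \<in> cball w (D / 8)"
    and umax: "\<And>v. v \<in> cball w (D / 8) \<Longrightarrow> norm (deriv g v) \<le> norm (deriv g u)"
    using continuous_attains_sup[of "cball w (D / 8)" "\<lambda>v. norm (deriv g v)"] \<open>0 < D\<close>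
      continuous_on_norm[OF continuous_on_subset[OF contg' sub]]
    by auto
  define S where "S = D * norm (deriv g u)"
  have "0 \<le> S" using \<open>0 < D\<close> by (simp add: S_def)
  have lip: "norm (g x - g y) \<le> norm (x - y) * (S / D)" if "x \<in> cball w (D / 8)" "y \<in> cball w (D / 8)" for x y
  proof -
    have "norm (g x - g y) \<le> norm (deriv g u) * norm (x - y)"
    proof (rule field_differentiable_bound)
      show "(g has_field_derivative deriv g v) (at v within cball w (D / 8))" if "v \<in> cball w (D / 8)" for v
        using that sub g open_\<Omega> by (intro DERIV_subset[OF holomorphic_derivI[of g \<Omega>]]) auto
    qed (use that umax in auto)
    then show ?thesis using \<open>0 < D\<close> by (simp add: S_def mult_ac)
  qed
  have ball_eq: "emeasure lborel (ball v (D / 8)) = ennreal (pi * D\<^sup>2 / 64)" for v :: complex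
    using \<open>0 < D\<close> by (subst emeasure_ball) (auto simp: unit_ball_vol_2 power_divide)
  have S_le: "ennreal (S powr p) * ennreal (pi * D\<^sup>2 / 64)
      \<le> (\<integral>\<^sup>+v\<in>ball w (D / 4). ennreal (1024 * 4 powr p) * ennreal (norm (deriv g v) powr p * \<delta> v powr p) \<partial>lborel)"
  proof -
    have uv: "dist w v < D / 4" if "dist u v < D / 8" for v
      using that u dist_triangle[of w v u] by simp
    have "cball u (D / 8) \<subseteq> ball w D"
    proof
      fix v assume "v \<in> cball u (D / 8)"
      then show "v \<in> ball w D" using u \<open>0 < D\<close> dist_triangle[of w v u] by simp
    qed
    then have "cball u (D / 8) \<subseteq> \<Omega>" using ball_\<delta>_subset[OF w] by (auto simp: D_def)
    then have "ennreal (norm (deriv g u) powr p * (pi * (D / 8)\<^sup>2))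
        \<le> ennreal (1024 * 2 powr p) * (\<integral>\<^sup>+v\<in>ball u (D / 8). ennreal (norm (deriv g v) powr p) \<partial>lborel)"
      using open_\<Omega> holg' \<open>0 < D\<close> \<open>1 \<le> p\<close> by (intro powr_submean_value) auto
    then have "ennreal (D powr p) * ennreal (norm (deriv g u) powr p * (pi * (D / 8)\<^sup>2))
        \<le> ennreal (D powr p) * (ennreal (1024 * 2 powr p) * (\<integral>\<^sup>+v\<in>ball u (D / 8). ennreal (norm (deriv g v) powr p) \<partial>lborel))"
      by (rule mult_left_mono) simp
    also have "ennreal (D powr p) * ennreal (norm (deriv g u) powr p * (pi * (D / 8)\<^sup>2))
        = ennreal (S powr p) * ennreal (pi * D\<^sup>2 / 64)"
      using \<open>0 < D\<close> by (simp add: S_def powr_mult power_divide mult_ac flip: ennreal_mult)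
    also have "ennreal (D powr p) * (ennreal (1024 * 2 powr p) * (\<integral>\<^sup>+v\<in>ball u (D / 8). ennreal (norm (deriv g v) powr p) \<partial>lborel))
      = ennreal (D powr p * (1024 * 2 powr p)) * (\<integral>\<^sup>+v\<in>ball u (D / 8). ennreal (norm (deriv g v) powr p) \<partial>lborel)"
      by (simp add: ennreal_mult mult.assoc)
    also have "\<dots> = (\<integral>\<^sup>+v. ennreal (D powr p * (1024 * 2 powr p)) * (ennreal (norm (deriv g v) powr p) * indicator (ball u (D / 8)) v) \<partial>lborel)"
    proof (rule nn_integral_cmult[symmetric])
      \<comment> \<open>Nothing is known about \<open>deriv g\<close> outside
        \<open>\<Omega>\<close>, so measurability comes from continuity on the ball after cutting
        off by its indicator.\<close>
      have "(\<lambda>v. indicator (ball u (D / 8)) v *\<^sub>R deriv g v) \<in> borel_measurable borel"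
        using \<open>cball u (D / 8) \<subseteq> \<Omega>\<close> ball_subset_cball[of u "D / 8"]
        by (intro borel_measurable_continuous_on_indicator continuous_on_subset[OF contg']) auto
      then have "(\<lambda>v. ennreal (norm (indicator (ball u (D / 8)) v *\<^sub>R deriv g v) powr p)) \<in> borel_measurable lborel"
        by measurable
      also have "(\<lambda>v. ennreal (norm (indicator (ball u (D / 8)) v *\<^sub>R deriv g v) powr p))
          = (\<lambda>v. ennreal (norm (deriv g v) powr p) * indicator (ball u (D / 8)) v)"
        by (auto simp: indicator_def)
      finally show "(\<lambda>v. ennreal (norm (deriv g v) powr p) * indicator (ball u (D / 8)) v) \<in> borel_measurable lborel" .
    qed
    also have "\<dots> \<le> (\<integral>\<^sup>+v\<in>ball w (D / 4). ennreal (1024 * 4 powr p) * ennreal (norm (deriv g v) powr p * \<delta> v powr p) \<partial>lborel)"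
    proof (rule nn_integral_mono)
      fix v
      show "ennreal (D powr p * (1024 * 2 powr p)) * (ennreal (norm (deriv g v) powr p) * indicator (ball u (D / 8)) v)
        \<le> ennreal (1024 * 4 powr p) * ennreal (norm (deriv g v) powr p * \<delta> v powr p) * indicator (ball w (D / 4)) v"
      proof (cases "v \<in> ball u (D / 8)")
        case True
        then have "dist w v < \<delta> w / 4" using uv by (simp add: D_def)
        then have "D \<le> 2 * \<delta> v" using \<delta>_comparable(3)[OF w, of v] \<delta>_nonneg[of v] by (simp add: D_def)
        then have "D powr p \<le> (2 * \<delta> v) powr p" using \<open>0 < D\<close> \<open>1 \<le> p\<close> by (intro powr_mono2) auto
        then have "D powr p * (1024 * 2 powr p) * norm (deriv g v) powr p
            \<le> (2 * \<delta> v) powr p * (1024 * 2 powr p) * norm (deriv g v) powr p"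
          by (intro mult_right_mono) auto
        \<comment> \<open>One factor 2 comes from the sub-mean value inequality, the other from
          \<open>D \<le> 2 * \<delta> v\<close>; together they give \<open>4 powr p\<close>.\<close>
        also have "\<dots> = 1024 * (2 * 2) powr p * (norm (deriv g v) powr p * \<delta> v powr p)"
          using \<delta>_nonneg[of v] by (subst (1 2) powr_mult) auto
        finally show ?thesis
          using True uv by (auto simp flip: ennreal_mult intro!: ennreal_leI)
      qed simp
    qed
    finally show ?thesis .
  qed
  show thesis
    using \<open>0 \<le> S\<close> lip S_le by (intro that) (simp_all only: D_def)
qed

text \<open>Truncation at \<open>N\<close> does not increase differences, so \<open>h\<close>
  inherits the Lipschitz bound of \<open>g\<close>. The bound from \<open>absorb\<close> then holds
  with every point \<open>v\<close> of the disc as reference point, and averaging over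
  \<open>v\<close> yields the integral. The factor \<open>dist z1 z2 / \<delta> w\<close> is kept
  for the summation along a curve.\<close>

lemma local_oscillation:
  fixes g :: "complex \<Rightarrow> complex" and N p e C :: real
  defines "h \<equiv> \<lambda>z. min (norm (g z)) N"
  assumes g: "g holomorphic_on \<Omega>" and "1 \<le> p" "0 \<le> N" "0 \<le> e" "0 \<le> C"
    and absorb: "\<And>S h. 0 \<le> S \<Longrightarrow> 0 \<le> h \<Longrightarrow> p * S * (h + S) powr (p - 1) \<le> e * h powr p + C * S powr p"
    and w: "w \<in> \<Omega>" and z12: "z1 \<in> ball w (\<delta> w / 8)" "z2 \<in> ball w (\<delta> w / 8)"
  shows "ennreal \<bar>h z1 powr p - h z2 powr p\<bar> * ennreal (pi * (\<delta> w)\<^sup>2 / 64)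
     \<le> ennreal (dist z1 z2 / \<delta> w) * (\<integral>\<^sup>+v\<in>ball w (\<delta> w / 4).
          (ennreal e * ennreal (h v powr p)
           + ennreal (C * (1024 * 4 powr p)) * ennreal (norm (deriv g v) powr p * \<delta> v powr p)) \<partial>lborel)"
proof -
  define D where "D = \<delta> w"
  have "0 < D" using \<delta>_pos w by (simp add: D_def)
  have holg': "deriv g holomorphic_on \<Omega>" using g open_\<Omega> by (rule holomorphic_deriv)
  have contg: "continuous_on \<Omega> g" and contg': "continuous_on \<Omega> (deriv g)"
    using g holg' holomorphic_on_imp_continuous_on by auto
  obtain S where "0 \<le> S"
    and lip: "\<And>x y. x \<in> cball w (D / 8) \<Longrightarrow> y \<in> cball w (D / 8) \<Longrightarrow> norm (g x - g y) \<le> norm (x - y) * (S / D)"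
    and S_le: "ennreal (S powr p) * ennreal (pi * D\<^sup>2 / 64)
      \<le> (\<integral>\<^sup>+v\<in>ball w (D / 4). ennreal (1024 * 4 powr p) * ennreal (norm (deriv g v) powr p * \<delta> v powr p) \<partial>lborel)"
    using local_derivative_bound[OF g \<open>1 \<le> p\<close> w] unfolding D_def by blast
  have hlip: "\<bar>h x - h y\<bar> \<le> norm (g x - g y)" for x y
    using norm_triangle_ineq3[of "g x" "g y"] by (auto simp: h_def min_def)
  have h0: "0 \<le> h x" for x using \<open>0 \<le> N\<close> by (simp add: h_def)
  have hle: "h x \<le> h v + S" if "x \<in> cball w (D / 8)" "v \<in> cball w (D / 8)" for x v
  proof -
    have "h x - h v \<le> norm (x - v) * (S / D)"
      using hlip[of x v] lip[OF that] by linarith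
    also have "\<dots> \<le> D * (S / D)"
      using that \<open>0 < D\<close> \<open>0 \<le> S\<close> dist_triangle2[of x v w]
      by (intro mult_right_mono) (auto simp: dist_norm norm_minus_commute)
    finally show ?thesis using \<open>0 < D\<close> by simp
  qed
  have z12': "z1 \<in> cball w (D / 8)" "z2 \<in> cball w (D / 8)" using z12 by (auto simp: D_def)
  have pointwise: "\<bar>h z1 powr p - h z2 powr p\<bar> \<le> dist z1 z2 / D * (e * h v powr p + C * S powr p)"
    if v: "v \<in> cball w (D / 8)" for v
  proof -
    \<comment> \<open>By \<open>hle\<close>, \<open>h v + S\<close> dominates both values of
      \<open>h\<close>, so it can be the upper endpoint in the mean value bound.\<close>
    have "\<bar>h z1 powr p - h z2 powr p\<bar> \<le> p * \<bar>h z1 - h z2\<bar> * (h v + S) powr (p - 1)"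
      using hle v z12' h0 \<open>1 \<le> p\<close> by (intro powr_diff_le) auto
    also have "\<dots> \<le> p * (dist z1 z2 * (S / D)) * (h v + S) powr (p - 1)"
      using hlip[of z1 z2] lip[OF z12'] \<open>1 \<le> p\<close>
      by (intro mult_right_mono mult_left_mono) (auto simp: dist_norm)
    also have "\<dots> = dist z1 z2 / D * (p * S * (h v + S) powr (p - 1))" by simp
    also have "\<dots> \<le> dist z1 z2 / D * (e * h v powr p + C * S powr p)"
      using \<open>0 < D\<close> \<open>0 \<le> S\<close> h0 by (intro mult_left_mono absorb) auto
    finally show ?thesis .
  qed
  have ball_eq: "emeasure lborel (ball v (D / 8)) = ennreal (pi * D\<^sup>2 / 64)" for v :: complex
    using \<open>0 < D\<close> by (subst emeasure_ball) (auto simp: unit_ball_vol_2 power_divide)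
  have meas_h: "(\<lambda>v. ennreal (h v powr p) * indicator A v) \<in> borel_measurable lborel"
    if "A \<subseteq> \<Omega>" "A \<in> sets borel" for A
  proof -
    have "(\<lambda>v. indicator A v *\<^sub>R g v) \<in> borel_measurable borel"
      using that by (intro borel_measurable_continuous_on_indicator continuous_on_subset[OF contg]) auto
    then have "(\<lambda>v. ennreal (min (norm (indicator A v *\<^sub>R g v)) N powr p) * indicator A v) \<in> borel_measurable lborel"
      using that(2) by measurable
    also have "(\<lambda>v. ennreal (min (norm (indicator A v *\<^sub>R g v)) N powr p) * indicator A v)
        = (\<lambda>v. ennreal (h v powr p) * indicator A v)"
      by (auto simp: indicator_def h_def)
    finally show ?thesis .
  qed
  have b4: "ball w (D / 4) \<subseteq> \<Omega>" using \<delta>_comparable(1)[OF w] by (auto simp: D_def)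
  have b8: "ball w (D / 8) \<subseteq> \<Omega>" using b4 subset_ball[of "D / 8" "D / 4" w] \<open>0 < D\<close> by force
  have "ennreal \<bar>h z1 powr p - h z2 powr p\<bar> * ennreal (pi * D\<^sup>2 / 64)
     = (\<integral>\<^sup>+v\<in>ball w (D / 8). ennreal \<bar>h z1 powr p - h z2 powr p\<bar> \<partial>lborel)"
    by (subst nn_integral_cmult_indicator) (auto simp: ball_eq)
  also have "\<dots> \<le> (\<integral>\<^sup>+v. ennreal (dist z1 z2 / D) *
      (ennreal e * (ennreal (h v powr p) * indicator (ball w (D / 8)) v)
        + ennreal (C * S powr p) * indicator (ball w (D / 8)) v) \<partial>lborel)"
  proof (rule nn_integral_mono)
    fix v
    show "ennreal \<bar>h z1 powr p - h z2 powr p\<bar> * indicator (ball w (D / 8)) v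
       \<le> ennreal (dist z1 z2 / D) *
      (ennreal e * (ennreal (h v powr p) * indicator (ball w (D / 8)) v)
        + ennreal (C * S powr p) * indicator (ball w (D / 8)) v)"
      using pointwise[of v] \<open>0 \<le> e\<close> \<open>0 \<le> C\<close> \<open>0 < D\<close>
      by (auto simp: indicator_def simp flip: ennreal_mult ennreal_plus intro!: ennreal_leI)
  qed
  also have "\<dots> = ennreal (dist z1 z2 / D) *
      (ennreal e * (\<integral>\<^sup>+v\<in>ball w (D / 8). ennreal (h v powr p) \<partial>lborel)
        + ennreal C * (ennreal (S powr p) * ennreal (pi * D\<^sup>2 / 64)))"
  proof -
    let ?h = "\<lambda>v. ennreal (h v powr p) * indicator (ball w (D / 8)) v"
    have mh: "?h \<in> borel_measurable lborel" using b8 by (intro meas_h) auto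
    have mi: "(\<lambda>v. ennreal (C * S powr p) * indicator (ball w (D / 8)) v) \<in> borel_measurable lborel"
      by (intro borel_measurable_times_ennreal borel_measurable_indicator borel_measurable_const) simp
    have "(\<integral>\<^sup>+v. ennreal (C * S powr p) * indicator (ball w (D / 8)) v \<partial>lborel)
        = ennreal C * (ennreal (S powr p) * ennreal (pi * D\<^sup>2 / 64))"
      using \<open>0 \<le> C\<close>
      by (subst nn_integral_cmult_indicator) (auto simp: ball_eq ennreal_mult mult.assoc)
    moreover have meh: "(\<lambda>v. ennreal e * ?h v) \<in> borel_measurable lborel"
      by (rule borel_measurable_times_ennreal[OF borel_measurable_const mh])
    ultimately show ?thesis
      by (simp only: nn_integral_cmult[OF borel_measurable_add[OF meh mi]]
            nn_integral_add[OF meh mi] nn_integral_cmult[OF mh])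
  qed
  also have "\<dots> \<le> ennreal (dist z1 z2 / D) *
      (ennreal e * (\<integral>\<^sup>+v\<in>ball w (D / 4). ennreal (h v powr p) \<partial>lborel)
        + ennreal C * (\<integral>\<^sup>+v\<in>ball w (D / 4). ennreal (1024 * 4 powr p) * ennreal (norm (deriv g v) powr p * \<delta> v powr p) \<partial>lborel))"
    using S_le \<open>0 < D\<close>
    by (intro mult_left_mono add_mono nn_integral_mono) (auto simp: indicator_def)
  also have "\<dots> = ennreal (dist z1 z2 / D) * (\<integral>\<^sup>+v\<in>ball w (D / 4).
          (ennreal e * ennreal (h v powr p)
           + ennreal (C * (1024 * 4 powr p)) * ennreal (norm (deriv g v) powr p * \<delta> v powr p)) \<partial>lborel)"
  proof -
    have "(\<lambda>v. indicator (ball w (D / 4)) v *\<^sub>R deriv g v) \<in> borel_measurable borel"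
      using b4 by (intro borel_measurable_continuous_on_indicator continuous_on_subset[OF contg']) auto
    then have "(\<lambda>v. ennreal (norm (indicator (ball w (D / 4)) v *\<^sub>R deriv g v) powr p * \<delta> v powr p)) \<in> borel_measurable lborel"
      by measurable
    also have "(\<lambda>v. ennreal (norm (indicator (ball w (D / 4)) v *\<^sub>R deriv g v) powr p * \<delta> v powr p))
        = (\<lambda>v. ennreal (norm (deriv g v) powr p * \<delta> v powr p) * indicator (ball w (D / 4)) v)"
      by (auto simp: indicator_def)
    finally have m: "(\<lambda>v. ennreal (norm (deriv g v) powr p * \<delta> v powr p) * indicator (ball w (D / 4)) v) \<in> borel_measurable lborel" .
    let ?f = "\<lambda>v. ennreal (norm (deriv g v) powr p * \<delta> v powr p) * indicator (ball w (D / 4)) v"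
    let ?h = "\<lambda>v. ennreal (h v powr p) * indicator (ball w (D / 4)) v"
    have mh: "?h \<in> borel_measurable lborel" using b4 by (intro meas_h) auto
    have "(\<integral>\<^sup>+v\<in>ball w (D / 4). ennreal (1024 * 4 powr p) * ennreal (norm (deriv g v) powr p * \<delta> v powr p) \<partial>lborel)
       = ennreal (1024 * 4 powr p) * (\<integral>\<^sup>+v. ?f v \<partial>lborel)"
      by (simp only: mult.assoc nn_integral_cmult[OF m])
    then have "ennreal e * (\<integral>\<^sup>+v. ?h v \<partial>lborel)
        + ennreal C * (\<integral>\<^sup>+v\<in>ball w (D / 4). ennreal (1024 * 4 powr p) * ennreal (norm (deriv g v) powr p * \<delta> v powr p) \<partial>lborel)
      = ennreal e * (\<integral>\<^sup>+v. ?h v \<partial>lborel) + ennreal (C * (1024 * 4 powr p)) * (\<integral>\<^sup>+v. ?f v \<partial>lborel)"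
      using \<open>0 \<le> C\<close> by (simp only: ennreal_mult' mult.assoc)
    also have "\<dots> = (\<integral>\<^sup>+v. ennreal e * ?h v + ennreal (C * (1024 * 4 powr p)) * ?f v \<partial>lborel)"
      by (simp only: nn_integral_cmult[OF mh] nn_integral_cmult[OF m]
           nn_integral_add[OF borel_measurable_times_ennreal[OF borel_measurable_const mh]
             borel_measurable_times_ennreal[OF borel_measurable_const m]])
    also have "\<dots> = (\<integral>\<^sup>+v\<in>ball w (D / 4).
          (ennreal e * ennreal (h v powr p)
           + ennreal (C * (1024 * 4 powr p)) * ennreal (norm (deriv g v) powr p * \<delta> v powr p)) \<partial>lborel)"
      by (intro nn_integral_cong) (simp add: distrib_right mult.assoc)
    finally show ?thesis by (simp only:)
  qed
  finally show ?thesis by (simp add: D_def)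
qed

section \<open>Integration along curves and Fubini\<close>

text \<open>The estimate adds up over adjacent intervals, so by \<open>Bolzano\<close> it suffices
  to treat short ones. There \<open>osc\<close>, centred at any \<open>\<gamma> u\<close> in
  between, bounds the difference quotient by the integrand at \<open>u\<close>; integrate over
  \<open>u\<close>. The third power of \<open>\<delta>\<close> collects the area of the disc and the
  divisor of \<open>dist z1 z2\<close>.\<close>

lemma path_oscillation:
  fixes \<phi> :: "complex \<Rightarrow> real" and F :: "complex \<Rightarrow> ennreal"
  assumes lip: "\<And>s t. dist (\<gamma> s) (\<gamma> t) \<le> \<bar>s - t\<bar>" and in_\<Omega>: "\<And>t. \<gamma> t \<in> \<Omega>"
    and F [measurable]: "F \<in> borel_measurable borel"
    and osc: "\<And>w z1 z2. w \<in> \<Omega> \<Longrightarrow> z1 \<in> ball w (\<delta> w / 8) \<Longrightarrow> z2 \<in> ball w (\<delta> w / 8) \<Longrightarrow>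
       ennreal \<bar>\<phi> z1 - \<phi> z2\<bar> * ennreal (pi * (\<delta> w)\<^sup>2 / 64)
         \<le> ennreal (dist z1 z2 / \<delta> w) * (\<integral>\<^sup>+v\<in>ball w (\<delta> w / 4). F v \<partial>lborel)"
    and "a \<le> b"
  shows "ennreal \<bar>\<phi> (\<gamma> a) - \<phi> (\<gamma> b)\<bar>
    \<le> (\<integral>\<^sup>+t\<in>{a<..b}. (\<integral>\<^sup>+v. ennreal (64 / (pi * \<delta> (\<gamma> t) ^ 3)) * (F v * indicator (ball (\<gamma> t) (\<delta> (\<gamma> t) / 4)) v) \<partial>lborel) \<partial>lborel)"
proof -
  define V where "V t = (\<integral>\<^sup>+v. ennreal (64 / (pi * \<delta> (\<gamma> t) ^ 3)) * (F v * indicator (ball (\<gamma> t) (\<delta> (\<gamma> t) / 4)) v) \<partial>lborel)" for t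
  have [measurable]: "\<gamma> \<in> borel_measurable borel"
    using lip by (rule borel_measurable_lipschitz)
  have V_meas [measurable]: "V \<in> borel_measurable borel"
  proof -
    \<comment> \<open>The ball moves with \<open>t\<close>; writing its indicator as a condition on
      \<open>t\<close> and \<open>v\<close> exhibits joint measurability.\<close>
    have "V = (\<lambda>t. \<integral>\<^sup>+v. ennreal (64 / (pi * \<delta> (\<gamma> t) ^ 3)) * (F v * (if dist (\<gamma> t) v < \<delta> (\<gamma> t) / 4 then 1 else 0)) \<partial>lborel)"
      by (intro ext) (simp add: V_def indicator_def of_bool_def)
    then show ?thesis by simp
  qed
  have "ennreal \<bar>\<phi> (\<gamma> a) - \<phi> (\<gamma> b)\<bar> \<le> (\<integral>\<^sup>+t\<in>{a<..b}. V t \<partial>lborel)"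
    using \<open>a \<le> b\<close>
  proof (induction rule: Bolzano)
    case (trans a b c)
    have "ennreal \<bar>\<phi> (\<gamma> a) - \<phi> (\<gamma> c)\<bar> \<le> ennreal \<bar>\<phi> (\<gamma> a) - \<phi> (\<gamma> b)\<bar> + ennreal \<bar>\<phi> (\<gamma> b) - \<phi> (\<gamma> c)\<bar>"
      by (simp flip: ennreal_plus)
    also have "\<dots> \<le> (\<integral>\<^sup>+t\<in>{a<..b}. V t \<partial>lborel) + (\<integral>\<^sup>+t\<in>{b<..c}. V t \<partial>lborel)"
      using trans by (intro add_mono)
    also have "\<dots> = (\<integral>\<^sup>+t. V t * indicator {a<..b} t + V t * indicator {b<..c} t \<partial>lborel)"
      by (rule nn_integral_add[symmetric]) auto
    also have "\<dots> = (\<integral>\<^sup>+t\<in>{a<..c}. V t \<partial>lborel)"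
      using trans by (intro nn_integral_cong) (auto simp: indicator_def)
    finally show ?case .
  next
    case (local x)
    \<comment> \<open>Within distance \<open>d\<close> of \<open>\<gamma> x\<close> the boundary
      distance is still above \<open>8 * d\<close>, so both endpoints lie in the disc around
      \<open>\<gamma> u\<close> on which \<open>osc\<close> applies.\<close>
    define d where "d = \<delta> (\<gamma> x) / 20"
    have "0 < d" using \<delta>_pos[OF in_\<Omega>] by (simp add: d_def)
    moreover have "ennreal \<bar>\<phi> (\<gamma> s) - \<phi> (\<gamma> t)\<bar> \<le> (\<integral>\<^sup>+u\<in>{s<..t}. V u \<partial>lborel)"
      if st: "s \<le> x" "x \<le> t" "t - s < d" for s t
    proof (cases "s = t")
      case False
      then have "s < t" using st by simp
      have V_ge: "ennreal (\<bar>\<phi> (\<gamma> s) - \<phi> (\<gamma> t)\<bar> / (t - s)) \<le> V u" if u: "u \<in> {s<..t}" for u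
      proof -
        let ?D = "\<delta> (\<gamma> u)"
        have "0 < ?D" using \<delta>_pos[OF in_\<Omega>] .
        have "dist (\<gamma> x) (\<gamma> u) < d" "dist (\<gamma> u) (\<gamma> s) < d" "dist (\<gamma> u) (\<gamma> t) < d"
          using lip[of x u] lip[of u s] lip[of u t] u st by (auto simp: abs_if split: if_splits)
        moreover have "8 * d < ?D"
          using \<delta>_lipschitz[of "\<gamma> x" "\<gamma> u"] \<open>0 < d\<close> \<open>dist (\<gamma> x) (\<gamma> u) < d\<close> by (simp add: d_def)
        ultimately have "ennreal \<bar>\<phi> (\<gamma> s) - \<phi> (\<gamma> t)\<bar> * ennreal (pi * ?D\<^sup>2 / 64)
          \<le> ennreal (dist (\<gamma> s) (\<gamma> t) / ?D) * (\<integral>\<^sup>+v\<in>ball (\<gamma> u) (?D / 4). F v \<partial>lborel)"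
          using in_\<Omega> by (intro osc) auto
        also have "\<dots> \<le> ennreal ((t - s) / ?D) * (\<integral>\<^sup>+v\<in>ball (\<gamma> u) (?D / 4). F v \<partial>lborel)"
          using lip[of s t] \<open>s < t\<close> \<open>0 < ?D\<close>
          by (intro mult_right_mono ennreal_leI divide_right_mono) auto
        finally have "ennreal (64 / (pi * ?D\<^sup>2) / (t - s)) * (ennreal \<bar>\<phi> (\<gamma> s) - \<phi> (\<gamma> t)\<bar> * ennreal (pi * ?D\<^sup>2 / 64))
          \<le> ennreal (64 / (pi * ?D\<^sup>2) / (t - s)) * (ennreal ((t - s) / ?D) * (\<integral>\<^sup>+v\<in>ball (\<gamma> u) (?D / 4). F v \<partial>lborel))"
          by (rule mult_left_mono) simp
        also have "\<dots> = ennreal (64 / (pi * ?D\<^sup>2) / (t - s) * ((t - s) / ?D)) * (\<integral>\<^sup>+v\<in>ball (\<gamma> u) (?D / 4). F v \<partial>lborel)"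
          using \<open>s < t\<close> \<open>0 < ?D\<close> by (subst ennreal_mult) (auto simp: mult.assoc)
        also have "64 / (pi * ?D\<^sup>2) / (t - s) * ((t - s) / ?D) = 64 / (pi * ?D ^ 3)"
        proof -
          have *: "X / (t - s) * ((t - s) / Y) = X / Y" for X Y :: real
            using \<open>s < t\<close> by simp
          show ?thesis by (subst *) (simp add: power3_eq_cube power2_eq_square)
        qed
        also have "ennreal (64 / (pi * ?D ^ 3)) * (\<integral>\<^sup>+v\<in>ball (\<gamma> u) (?D / 4). F v \<partial>lborel) = V u"
          unfolding V_def using F
          by (intro nn_integral_cmult[symmetric] borel_measurable_times_ennreal borel_measurable_indicator) simp_all
        also have "ennreal (64 / (pi * ?D\<^sup>2) / (t - s)) * (ennreal \<bar>\<phi> (\<gamma> s) - \<phi> (\<gamma> t)\<bar> * ennreal (pi * ?D\<^sup>2 / 64))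
          = ennreal (\<bar>\<phi> (\<gamma> s) - \<phi> (\<gamma> t)\<bar> / (t - s))"
        proof -
          have *: "64 / (pi * X) / Y * (Z * (pi * X / 64)) = Z / Y" if "X \<noteq> 0" for X Y Z :: real
            using that by simp
          have "?D\<^sup>2 \<noteq> 0" using \<open>0 < ?D\<close> by simp
          then have "64 / (pi * ?D\<^sup>2) / (t - s) * (\<bar>\<phi> (\<gamma> s) - \<phi> (\<gamma> t)\<bar> * (pi * ?D\<^sup>2 / 64))
              = \<bar>\<phi> (\<gamma> s) - \<phi> (\<gamma> t)\<bar> / (t - s)"
            by (rule *)
          moreover have "0 \<le> 64 / (pi * ?D\<^sup>2) / (t - s)" using \<open>s < t\<close> by simp
          ultimately show ?thesis by (metis ennreal_mult' ennreal_mult'' zero_le_divide_iff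
                abs_ge_zero pi_ge_zero mult_nonneg_nonneg zero_le_power2 zero_le_numeral)
        qed
        finally show ?thesis .
      qed
      have "ennreal \<bar>\<phi> (\<gamma> s) - \<phi> (\<gamma> t)\<bar> = ennreal (\<bar>\<phi> (\<gamma> s) - \<phi> (\<gamma> t)\<bar> / (t - s)) * ennreal (t - s)"
        using \<open>s < t\<close> by (simp flip: ennreal_mult)
      also have "\<dots> = (\<integral>\<^sup>+u\<in>{s<..t}. ennreal (\<bar>\<phi> (\<gamma> s) - \<phi> (\<gamma> t)\<bar> / (t - s)) \<partial>lborel)"
        using \<open>s < t\<close> by (subst nn_integral_cmult_indicator) auto
      also have "\<dots> \<le> (\<integral>\<^sup>+u\<in>{s<..t}. V u \<partial>lborel)"
        using V_ge by (intro nn_integral_mono) (auto simp: indicator_def)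
      finally show ?thesis .
    qed simp
    ultimately show ?case by blast
  qed
  then show ?thesis by (simp add: V_def)
qed

text \<open>After Fubini, fix \<open>v\<close>. It lies in the disc around \<open>\<gamma> t\<close>
  only if \<open>c * t \<le> \<delta> (\<gamma> t) \<le> 4 / 3 * \<delta> v\<close>, hence only for
  times up to \<open>4 / (3 * c) * \<delta> v\<close>. Multiplying this time by the kernel bound
  \<open>64 / \<delta> v ^ 3\<close> leaves the inverse square of \<open>\<delta> v\<close>.\<close>

lemma john_curve_kernel:
  fixes F :: "complex \<Rightarrow> ennreal"
  assumes lip: "\<And>s t. dist (\<gamma> s) (\<gamma> t) \<le> \<bar>s - t\<bar>" and in_\<Omega>: "\<And>t. \<gamma> t \<in> \<Omega>"
    and F [measurable]: "F \<in> borel_measurable borel"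
    and "0 < c" and john: "\<And>t. 0 \<le> t \<Longrightarrow> t \<le> l \<Longrightarrow> c * t \<le> \<delta> (\<gamma> t)"
  shows "(\<integral>\<^sup>+t\<in>{0<..l}. (\<integral>\<^sup>+v. ennreal (64 / (pi * \<delta> (\<gamma> t) ^ 3)) * (F v * indicator (ball (\<gamma> t) (\<delta> (\<gamma> t) / 4)) v) \<partial>lborel) \<partial>lborel)
    \<le> ennreal (256 / (3 * c)) * (\<integral>\<^sup>+v\<in>{v\<in>\<Omega>. dist (\<gamma> 0) v < (4 / (3 * c) + 1) * \<delta> v}. ennreal (1 / (\<delta> v)\<^sup>2) * F v \<partial>lborel)"
proof -
  define B where "B = {v\<in>\<Omega>. dist (\<gamma> 0) v < (4 / (3 * c) + 1) * \<delta> v}"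
  have B_meas [measurable]: "B \<in> sets borel"
    unfolding B_def by measurable
  have [measurable]: "\<gamma> \<in> borel_measurable borel"
    using lip by (rule borel_measurable_lipschitz)
  define k where "k t v = ennreal (64 / (pi * \<delta> (\<gamma> t) ^ 3)) * (if dist (\<gamma> t) v < \<delta> (\<gamma> t) / 4 then 1 else 0) * indicator {0<..l} t" for t v
  have kb: "k t v \<le> ennreal (64 / \<delta> v ^ 3) * indicator B v * indicator {0<..4 / (3 * c) * \<delta> v} t" for t v
  proof (cases "dist (\<gamma> t) v < \<delta> (\<gamma> t) / 4 \<and> t \<in> {0<..l}")
    case True
    let ?D = "\<delta> (\<gamma> t)"
    have comp: "v \<in> \<Omega>" "\<delta> v \<le> 5 / 4 * ?D" "?D \<le> 4 / 3 * \<delta> v"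
      using True \<delta>_comparable[OF in_\<Omega>, of t v] by auto
    have "0 < ?D" "0 < \<delta> v" using \<delta>_pos in_\<Omega> comp by auto
    have "c * t \<le> 4 / 3 * \<delta> v" using john[of t] True comp by auto
    then have t: "t \<le> 4 / (3 * c) * \<delta> v" using \<open>0 < c\<close> by (simp add: field_simps)
    have "dist (\<gamma> 0) v \<le> dist (\<gamma> 0) (\<gamma> t) + dist (\<gamma> t) v" by (rule dist_triangle)
    also have "\<dots> < t + \<delta> v" using lip[of 0 t] True comp \<open>0 < \<delta> v\<close> by auto
    also have "\<dots> \<le> (4 / (3 * c) + 1) * \<delta> v" using t by (simp add: distrib_right)
    finally have "v \<in> B" using comp by (simp add: B_def)
    have "\<delta> v ^ 3 \<le> (5 / 4 * ?D) ^ 3" using comp \<open>0 < \<delta> v\<close> by (intro power_mono) auto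
    also have "\<dots> = 125 / 64 * ?D ^ 3" by (simp add: power_mult_distrib power_divide)
    \<comment> \<open>As 125/64 is below 3, the factor \<open>pi\<close> in the kernel absorbs the
      loss in comparing \<open>\<delta> v\<close> with \<open>?D\<close>.\<close>
    also have "\<dots> \<le> pi * ?D ^ 3"
      using \<open>0 < ?D\<close> pi_gt3 by (intro mult_right_mono) auto
    finally have "64 / (pi * ?D ^ 3) \<le> 64 / \<delta> v ^ 3"
      using \<open>0 < \<delta> v\<close> \<open>0 < ?D\<close> by (intro divide_left_mono) auto
    then show ?thesis using True t \<open>v \<in> B\<close> by (auto simp: k_def intro!: ennreal_leI)
  next
    case False
    then show ?thesis by (auto simp: k_def)
  qed
  have [measurable]: "(\<lambda>(t, v). k t v) \<in> borel_measurable (lborel \<Otimes>\<^sub>M lborel)"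
    unfolding k_def by measurable
  have "(\<integral>\<^sup>+t\<in>{0<..l}. (\<integral>\<^sup>+v. ennreal (64 / (pi * \<delta> (\<gamma> t) ^ 3)) * (F v * indicator (ball (\<gamma> t) (\<delta> (\<gamma> t) / 4)) v) \<partial>lborel) \<partial>lborel)
     = (\<integral>\<^sup>+t. (\<integral>\<^sup>+v. k t v * F v \<partial>lborel) \<partial>lborel)"
    by (intro nn_integral_cong) (auto simp: k_def indicator_def of_bool_def mult_ac)
  also have "\<dots> = (\<integral>\<^sup>+v. (\<integral>\<^sup>+t. k t v * F v \<partial>lborel) \<partial>lborel)"
    by (rule lborel_pair.Fubini'[symmetric]) measurable
  also have "\<dots> \<le> (\<integral>\<^sup>+v. ennreal (256 / (3 * c)) * (ennreal (1 / (\<delta> v)\<^sup>2) * F v * indicator B v) \<partial>lborel)"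
  proof (rule nn_integral_mono)
    fix v
    have "(\<integral>\<^sup>+t. k t v * F v \<partial>lborel)
      \<le> (\<integral>\<^sup>+t. (ennreal (64 / \<delta> v ^ 3) * indicator B v * F v) * indicator {0<..4 / (3 * c) * \<delta> v} t \<partial>lborel)"
    proof (rule nn_integral_mono)
      fix t
      have "k t v * F v \<le> ennreal (64 / \<delta> v ^ 3) * indicator B v * indicator {0<..4 / (3 * c) * \<delta> v} t * F v"
        by (intro mult_right_mono kb) simp
      then show "k t v * F v \<le> ennreal (64 / \<delta> v ^ 3) * indicator B v * F v * indicator {0<..4 / (3 * c) * \<delta> v} t"
        by (simp only: mult_ac)
    qed
    also have "\<dots> = (ennreal (64 / \<delta> v ^ 3) * indicator B v * F v) * ennreal (4 / (3 * c) * \<delta> v)"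
      using \<open>0 < c\<close> \<delta>_nonneg by (subst nn_integral_cmult_indicator) auto
    also have "\<dots> = (ennreal (64 / \<delta> v ^ 3) * ennreal (4 / (3 * c) * \<delta> v)) * (F v * indicator B v)"
      by (simp only: mult_ac)
    also have "ennreal (64 / \<delta> v ^ 3) * ennreal (4 / (3 * c) * \<delta> v) = ennreal (256 / (3 * c)) * ennreal (1 / (\<delta> v)\<^sup>2)"
      using \<open>0 < c\<close> \<delta>_nonneg[of v]
      by (simp add: power3_eq_cube power2_eq_square flip: ennreal_mult)
    finally show "(\<integral>\<^sup>+t. k t v * F v \<partial>lborel) \<le> ennreal (256 / (3 * c)) * (ennreal (1 / (\<delta> v)\<^sup>2) * F v * indicator B v)"
      by (simp add: mult.assoc)
  qed
  also have "\<dots> = ennreal (256 / (3 * c)) * (\<integral>\<^sup>+v\<in>B. ennreal (1 / (\<delta> v)\<^sup>2) * F v \<partial>lborel)"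
    by (rule nn_integral_cmult) measurable
  finally show ?thesis by (simp add: B_def)
qed

text \<open>Exchanging the integrals replaces the set of \<open>v\<close> seen from \<open>z\<close>
  by the set of \<open>z\<close> in the hypothesis \<open>shadow\<close>. The inverse square of
  \<open>\<delta> v\<close> then reduces the exponent \<open>a + 2\<close> to
  \<open>a\<close>.\<close>

lemma shadow_Fubini:
  fixes F :: "complex \<Rightarrow> ennreal"
  assumes F [measurable]: "F \<in> borel_measurable borel"
    and shadow: "\<And>w. w \<in> \<Omega> \<Longrightarrow>
       (\<integral>\<^sup>+z\<in>{z\<in>\<Omega>. dist z w < K * \<delta> w}. ennreal (\<delta> z powr a) \<partial>lborel) \<le> ennreal (C * \<delta> w powr (a + 2))"
    and "0 \<le> C"
  shows "(\<integral>\<^sup>+z\<in>\<Omega>. ennreal (\<delta> z powr a) *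
           (\<integral>\<^sup>+v\<in>{v\<in>\<Omega>. dist z v < K * \<delta> v}. ennreal (1 / (\<delta> v)\<^sup>2) * F v \<partial>lborel) \<partial>lborel)
    \<le> ennreal C * (\<integral>\<^sup>+v\<in>\<Omega>. F v * ennreal (\<delta> v powr a) \<partial>lborel)"
proof -
  define k where "k z v = ennreal (\<delta> z powr a) * indicator \<Omega> z * (ennreal (1 / (\<delta> v)\<^sup>2) * F v * (if v \<in> \<Omega> \<and> dist z v < K * \<delta> v then 1 else 0))" for z v
  have [measurable]: "(\<lambda>(z, v). k z v) \<in> borel_measurable (lborel \<Otimes>\<^sub>M lborel)"
    unfolding k_def by measurable
  have "(\<integral>\<^sup>+z\<in>\<Omega>. ennreal (\<delta> z powr a) *
           (\<integral>\<^sup>+v\<in>{v\<in>\<Omega>. dist z v < K * \<delta> v}. ennreal (1 / (\<delta> v)\<^sup>2) * F v \<partial>lborel) \<partial>lborel)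
     = (\<integral>\<^sup>+z. (\<integral>\<^sup>+v. k z v \<partial>lborel) \<partial>lborel)"
  proof (rule nn_integral_cong)
    fix z
    have "(\<integral>\<^sup>+v. k z v \<partial>lborel) = ennreal (\<delta> z powr a) * indicator \<Omega> z *
       (\<integral>\<^sup>+v. ennreal (1 / (\<delta> v)\<^sup>2) * F v * (if v \<in> \<Omega> \<and> dist z v < K * \<delta> v then 1 else 0) \<partial>lborel)"
      unfolding k_def by (rule nn_integral_cmult) measurable
    then show "ennreal (\<delta> z powr a) *
           (\<integral>\<^sup>+v\<in>{v\<in>\<Omega>. dist z v < K * \<delta> v}. ennreal (1 / (\<delta> v)\<^sup>2) * F v \<partial>lborel) * indicator \<Omega> z = (\<integral>\<^sup>+v. k z v \<partial>lborel)"
      by (simp add: indicator_def of_bool_def mult_ac)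
  qed
  also have "\<dots> = (\<integral>\<^sup>+v. (\<integral>\<^sup>+z. k z v \<partial>lborel) \<partial>lborel)"
    by (rule lborel_pair.Fubini'[symmetric]) measurable
  also have "\<dots> \<le> (\<integral>\<^sup>+v. ennreal C * (F v * ennreal (\<delta> v powr a) * indicator \<Omega> v) \<partial>lborel)"
  proof (rule nn_integral_mono)
    fix v
    show "(\<integral>\<^sup>+z. k z v \<partial>lborel) \<le> ennreal C * (F v * ennreal (\<delta> v powr a) * indicator \<Omega> v)"
    proof (cases "v \<in> \<Omega>")
      case True
      have "(\<integral>\<^sup>+z. k z v \<partial>lborel) = (\<integral>\<^sup>+z. ennreal (1 / (\<delta> v)\<^sup>2) * F v *
          (ennreal (\<delta> z powr a) * indicator {z\<in>\<Omega>. dist z v < K * \<delta> v} z) \<partial>lborel)"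
        using True by (intro nn_integral_cong) (auto simp: k_def indicator_def of_bool_def mult_ac)
      also have "\<dots> = ennreal (1 / (\<delta> v)\<^sup>2) * F v *
          (\<integral>\<^sup>+z\<in>{z\<in>\<Omega>. dist z v < K * \<delta> v}. ennreal (\<delta> z powr a) \<partial>lborel)"
        by (rule nn_integral_cmult) measurable
      also have "\<dots> \<le> ennreal (1 / (\<delta> v)\<^sup>2) * F v * ennreal (C * \<delta> v powr (a + 2))"
        using shadow[OF True] by (rule mult_left_mono) simp
      also have "\<dots> = (ennreal (1 / (\<delta> v)\<^sup>2) * ennreal (C * \<delta> v powr (a + 2))) * F v"
        by (simp only: mult_ac)
      also have "ennreal (1 / (\<delta> v)\<^sup>2) * ennreal (C * \<delta> v powr (a + 2)) = ennreal (C * \<delta> v powr a)"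
        using \<delta>_pos[OF True] \<open>0 \<le> C\<close> by (simp add: powr_add field_simps flip: ennreal_mult)
      finally show ?thesis using True \<open>0 \<le> C\<close> by (simp add: ennreal_mult mult_ac)
    qed (simp add: k_def)
  qed
  also have "\<dots> = ennreal C * (\<integral>\<^sup>+v\<in>\<Omega>. F v * ennreal (\<delta> v powr a) \<partial>lborel)"
    by (rule nn_integral_cmult) measurable
  finally show ?thesis .
qed

subsection \<open>Weighted norms\<close>

text \<open>This condition carries all the dependence on the boundary: the set of integration contains every
  point whose John curve passes near \<open>w\<close>.\<close>

definition shadow_condition :: "real \<Rightarrow> bool" where
  "shadow_condition a \<longleftrightarrow> (\<forall>K\<ge>1. \<exists>C\<ge>0. \<forall>w\<in>\<Omega>.
     (\<integral>\<^sup>+z\<in>{z\<in>\<Omega>. dist z w < K * \<delta> w}. ennreal (\<delta> z powr a) \<partial>lborel) \<le> ennreal (C * \<delta> w powr (a + 2)))"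

text \<open>No root is taken: this is the \<open>p\<close>-th power of the norm in the weighted
  Lebesgue space with weight \<open>\<delta> z powr a\<close>.\<close>

definition weighted_norm :: "real \<Rightarrow> real \<Rightarrow> (complex \<Rightarrow> complex) \<Rightarrow> ennreal" where
  "weighted_norm a p g = (\<integral>\<^sup>+z\<in>\<Omega>. ennreal (norm (g z) powr p * \<delta> z powr a) \<partial>lborel)"

text \<open>The values of \<open>g\<close> off \<open>\<Omega>\<close> are arbitrary, so
  measurability is stated after multiplication by the indicator; the other measurability proofs
  rewrite their integrands into this form.\<close>

lemma holomorphic_measurable:
  assumes "g holomorphic_on \<Omega>"
  shows "(\<lambda>z. indicator \<Omega> z *\<^sub>R g z) \<in> borel_measurable borel"
  using assms by (intro borel_measurable_continuous_on_indicator holomorphic_on_imp_continuous_on) auto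

lemma weighted_measurable:
  assumes "g holomorphic_on \<Omega>"
  shows "(\<lambda>z. ennreal (norm (g z) powr p * \<delta> z powr a) * indicator \<Omega> z) \<in> borel_measurable borel"
proof -
  have "(\<lambda>z. ennreal (norm (indicator \<Omega> z *\<^sub>R g z) powr p * \<delta> z powr a) * indicator \<Omega> z) \<in> borel_measurable borel"
    using holomorphic_measurable[OF assms] by measurable
  also have "(\<lambda>z. ennreal (norm (indicator \<Omega> z *\<^sub>R g z) powr p * \<delta> z powr a) * indicator \<Omega> z)
      = (\<lambda>z. ennreal (norm (g z) powr p * \<delta> z powr a) * indicator \<Omega> z)"
    by (auto simp: indicator_def)
  finally show ?thesis .
qed

text \<open>For \<open>K\<close> large enough, the region in the shadow condition for a single point
  \<open>w\<close> is all of the bounded set \<open>\<Omega>\<close>.\<close>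

lemma finite_mass:
  assumes "shadow_condition a"
  shows "(\<integral>\<^sup>+z\<in>\<Omega>. ennreal (\<delta> z powr a) \<partial>lborel) < top"
proof -
  obtain w where w: "w \<in> \<Omega>" using nonempty_\<Omega> by auto
  obtain R where R: "\<And>z. z \<in> \<Omega> \<Longrightarrow> dist w z \<le> R"
    using bounded_\<Omega> bounded_any_center[of \<Omega> w] by auto
  define K where "K = max 1 (R / \<delta> w + 1)"
  have "0 < \<delta> w" using w \<delta>_pos by simp
  have "{z\<in>\<Omega>. dist z w < K * \<delta> w} = \<Omega>"
  proof -
    have "R < K * \<delta> w"
    proof -
      have "R < (R / \<delta> w + 1) * \<delta> w" using \<open>0 < \<delta> w\<close> by (simp add: field_simps)
      also have "\<dots> \<le> K * \<delta> w" using \<open>0 < \<delta> w\<close> by (intro mult_right_mono) (auto simp: K_def)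
      finally show ?thesis .
    qed
    then show ?thesis using R by (force simp: dist_commute)
  qed
  moreover obtain C where "(\<integral>\<^sup>+z\<in>{z\<in>\<Omega>. dist z w < K * \<delta> w}. ennreal (\<delta> z powr a) \<partial>lborel) \<le> ennreal (C * \<delta> w powr (a + 2))"
  proof -
    have "1 \<le> K" by (simp add: K_def)
    then show thesis using assms w that unfolding shadow_condition_def by blast
  qed
  ultimately have "(\<integral>\<^sup>+z\<in>\<Omega>. ennreal (\<delta> z powr a) \<partial>lborel) \<le> ennreal (C * \<delta> w powr (a + 2))"
    by simp
  then show ?thesis by (rule le_less_trans[OF _ ennreal_less_top])
qed

text \<open>The lower estimate with the John centre \<open>x0\<close> as base point;
  \<open>center_change\<close> later moves the base point. The curves are defined on the whole real
  line, as \<open>path_oscillation\<close> requires.\<close>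

lemma weighted_poincare:
  assumes c: "0 < c" and john: "\<And>z. z \<in> \<Omega> \<Longrightarrow> \<exists>\<gamma> l. 0 \<le> l \<and> (\<forall>s t. dist (\<gamma> s) (\<gamma> t) \<le> \<bar>s - t\<bar>) \<and>
        (\<forall>t. \<gamma> t \<in> \<Omega>) \<and> \<gamma> 0 = z \<and> \<gamma> l = x0 \<and> (\<forall>t. 0 \<le> t \<longrightarrow> t \<le> l \<longrightarrow> c * t \<le> \<delta> (\<gamma> t))"
    and shadow: "shadow_condition a" and "1 \<le> p"
  shows "\<exists>C\<ge>0. \<forall>g. g holomorphic_on \<Omega> \<longrightarrow>
     weighted_norm a p g \<le> ennreal C * (ennreal (norm (g x0) powr p) + weighted_norm (a + p) p (deriv g))"
proof -
  \<comment> \<open>\<open>K\<close> and \<open>c2\<close> are the aperture and the constant of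
    \<open>john_curve_kernel\<close>.\<close>
  define K where "K = 4 / (3 * c) + 1"
  define c2 where "c2 = 256 / (3 * c)"
  have "1 \<le> K" "0 \<le> c2" using c by (auto simp: K_def c2_def)
  obtain CK where CK: "0 \<le> CK" "\<And>w. w \<in> \<Omega> \<Longrightarrow>
       (\<integral>\<^sup>+z\<in>{z\<in>\<Omega>. dist z w < K * \<delta> w}. ennreal (\<delta> z powr a) \<partial>lborel) \<le> ennreal (CK * \<delta> w powr (a + 2))"
    using shadow \<open>1 \<le> K\<close> unfolding shadow_condition_def by blast
  obtain m where m: "0 \<le> m" "(\<integral>\<^sup>+z\<in>\<Omega>. ennreal (\<delta> z powr a) \<partial>lborel) = ennreal m"
    using finite_mass[OF shadow] by (cases "(\<integral>\<^sup>+z\<in>\<Omega>. ennreal (\<delta> z powr a) \<partial>lborel)") auto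
  \<comment> \<open>Chosen so that after Fubini the term to be absorbed has coefficient at most 1/2;
    the summand 1 keeps the denominator positive when \<open>CK\<close> is 0.\<close>
  define e where "e = 1 / (2 * (c2 * CK + 1))"
  have "0 \<le> c2 * CK" using \<open>0 \<le> c2\<close> CK by simp
  then have "0 < e" "c2 * CK * e \<le> 1 / 2" by (auto simp: e_def field_simps)
  obtain C0 where "0 < C0" and absorb: "\<And>S h. 0 \<le> S \<Longrightarrow> 0 \<le> h \<Longrightarrow> p * S * (h + S) powr (p - 1) \<le> e * h powr p + C0 * S powr p"
    using powr_absorb[OF \<open>0 < e\<close> \<open>1 \<le> p\<close>] by blast
  define C1 where "C1 = C0 * (1024 * 4 powr p)"
  have "0 \<le> C1" using \<open>0 < C0\<close> by (simp add: C1_def)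
  define Ct where "Ct = max (2 * m) (2 * (c2 * CK * C1))"
  have "0 \<le> Ct" using m by (simp add: Ct_def)
  \<comment> \<open>Truncating \<open>|g|\<close> at \<open>N\<close> makes the left-hand side finite, so that it can be absorbed.\<close>
  have main: "(\<integral>\<^sup>+z\<in>\<Omega>. ennreal (min (norm (g z)) N powr p * \<delta> z powr a) \<partial>lborel)
      \<le> ennreal Ct * (ennreal (norm (g x0) powr p) + weighted_norm (a + p) p (deriv g))"
    if g: "g holomorphic_on \<Omega>" and "0 \<le> N" for g N
  proof -
    define h where "h z = min (norm (g z)) N" for z
    have h0: "0 \<le> h z" for z using \<open>0 \<le> N\<close> by (simp add: h_def)
    define F where "F v = (ennreal e * ennreal (h v powr p)
           + ennreal C1 * ennreal (norm (deriv g v) powr p * \<delta> v powr p)) * indicator \<Omega> v" for v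
    have mh [measurable]: "(\<lambda>v. ennreal (h v powr p) * indicator \<Omega> v) \<in> borel_measurable borel"
    proof -
      have "(\<lambda>v. ennreal (min (norm (indicator \<Omega> v *\<^sub>R g v)) N powr p) * indicator \<Omega> v) \<in> borel_measurable borel"
        using holomorphic_measurable[OF g] by measurable
      also have "(\<lambda>v. ennreal (min (norm (indicator \<Omega> v *\<^sub>R g v)) N powr p) * indicator \<Omega> v)
        = (\<lambda>v. ennreal (h v powr p) * indicator \<Omega> v)"
        by (auto simp: h_def indicator_def)
      finally show ?thesis .
    qed
    note [measurable] = weighted_measurable[OF holomorphic_deriv[OF g open_\<Omega>], of p]
    have F_eq: "F = (\<lambda>v. ennreal e * (ennreal (h v powr p) * indicator \<Omega> v)
           + ennreal C1 * (ennreal (norm (deriv g v) powr p * \<delta> v powr p) * indicator \<Omega> v))"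
      by (auto simp: F_def distrib_right mult.assoc)
    have F_meas [measurable]: "F \<in> borel_measurable borel"
      unfolding F_eq by measurable
    define B where "B z = {v\<in>\<Omega>. dist z v < K * \<delta> v}" for z
    define I where "I z = (\<integral>\<^sup>+v\<in>B z. ennreal (1 / (\<delta> v)\<^sup>2) * F v \<partial>lborel)" for z
    have I_meas [measurable]: "I \<in> borel_measurable borel"
    proof -
      have "I = (\<lambda>z. \<integral>\<^sup>+v. ennreal (1 / (\<delta> v)\<^sup>2) * F v * (if v \<in> \<Omega> \<and> dist z v < K * \<delta> v then 1 else 0) \<partial>lborel)"
        by (intro ext) (simp add: I_def B_def indicator_def of_bool_def)
      also have "\<dots> \<in> borel_measurable borel" by measurable
      finally show ?thesis .
    qed
    \<comment> \<open>The oscillation of \<open>h powr p\<close> is accumulated along the John curve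
      from \<open>z\<close> to \<open>x0\<close>, and the integral over the curve is converted into
      an area integral.\<close>
    have pointwise: "ennreal (h z powr p) \<le> ennreal (norm (g x0) powr p) + ennreal c2 * I z" if z: "z \<in> \<Omega>" for z
    proof -
      obtain \<gamma> l where \<gamma>: "0 \<le> l" "\<And>s t. dist (\<gamma> s) (\<gamma> t) \<le> \<bar>s - t\<bar>" "\<And>t. \<gamma> t \<in> \<Omega>" "\<gamma> 0 = z" "\<gamma> l = x0"
          "\<And>t. 0 \<le> t \<Longrightarrow> t \<le> l \<Longrightarrow> c * t \<le> \<delta> (\<gamma> t)"
        using john[OF z] by blast
      have osc: "ennreal \<bar>h z1 powr p - h z2 powr p\<bar> * ennreal (pi * (\<delta> w)\<^sup>2 / 64)
         \<le> ennreal (dist z1 z2 / \<delta> w) * (\<integral>\<^sup>+v\<in>ball w (\<delta> w / 4). F v \<partial>lborel)"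
        if w: "w \<in> \<Omega>" and z12: "z1 \<in> ball w (\<delta> w / 8)" "z2 \<in> ball w (\<delta> w / 8)" for w z1 z2
      proof -
        have "(\<integral>\<^sup>+v\<in>ball w (\<delta> w / 4). (ennreal e * ennreal (h v powr p)
           + ennreal C1 * ennreal (norm (deriv g v) powr p * \<delta> v powr p)) \<partial>lborel)
           = (\<integral>\<^sup>+v\<in>ball w (\<delta> w / 4). F v \<partial>lborel)"
          using \<delta>_comparable(1)[OF w] by (intro nn_integral_cong) (auto simp: F_def indicator_def)
        then show ?thesis
          using local_oscillation[OF g \<open>1 \<le> p\<close> \<open>0 \<le> N\<close> _ _ absorb w z12] \<open>0 < e\<close> \<open>0 < C0\<close>
          by (simp add: h_def[symmetric] C1_def)
      qed
      have "ennreal \<bar>h (\<gamma> 0) powr p - h (\<gamma> l) powr p\<bar>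
        \<le> (\<integral>\<^sup>+t\<in>{0<..l}. (\<integral>\<^sup>+v. ennreal (64 / (pi * \<delta> (\<gamma> t) ^ 3)) * (F v * indicator (ball (\<gamma> t) (\<delta> (\<gamma> t) / 4)) v) \<partial>lborel) \<partial>lborel)"
        using \<gamma>(2,3) F_meas osc \<gamma>(1) by (rule path_oscillation)
      also have "\<dots> \<le> ennreal c2 * I (\<gamma> 0)"
        unfolding c2_def I_def B_def K_def
        using \<gamma>(2,3) F_meas c \<gamma>(6) by (rule john_curve_kernel)
      finally have "ennreal \<bar>h z powr p - h x0 powr p\<bar> \<le> ennreal c2 * I z" by (simp add: \<gamma>)
      moreover have "ennreal (h z powr p) \<le> ennreal (h x0 powr p) + ennreal \<bar>h z powr p - h x0 powr p\<bar>"
        by (simp flip: ennreal_plus)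
      moreover have "ennreal (h x0 powr p) \<le> ennreal (norm (g x0) powr p)"
        using h0[of x0] \<open>1 \<le> p\<close> by (intro ennreal_leI powr_mono2) (auto simp: h_def)
      ultimately show ?thesis by (meson add_mono order_trans)
    qed
    define X where "X = (\<integral>\<^sup>+z\<in>\<Omega>. ennreal (h z powr p * \<delta> z powr a) \<partial>lborel)"
    define Y where "Y = weighted_norm (a + p) p (deriv g)"
    have X_fin: "X < top"
    proof -
      have "X \<le> (\<integral>\<^sup>+z. ennreal (N powr p) * (ennreal (\<delta> z powr a) * indicator \<Omega> z) \<partial>lborel)"
        unfolding X_def
      proof (rule nn_integral_mono)
        fix z
        have "h z powr p \<le> N powr p" using h0[of z] \<open>1 \<le> p\<close> by (intro powr_mono2) (auto simp: h_def)
        then show "ennreal (h z powr p * \<delta> z powr a) * indicator \<Omega> z \<le> ennreal (N powr p) * (ennreal (\<delta> z powr a) * indicator \<Omega> z)"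
          by (auto simp: indicator_def mult_right_mono simp flip: ennreal_mult intro!: ennreal_leI)
      qed
      also have "\<dots> = ennreal (N powr p) * ennreal m"
        by (subst nn_integral_cmult) (auto simp: m)
      finally show ?thesis by (simp add: ennreal_mult_less_top le_less_trans flip: ennreal_mult)
    qed
    \<comment> \<open>Against the weight \<open>\<delta> v powr a\<close>, the first part of
      \<open>F\<close> reproduces \<open>X\<close> with the small factor \<open>e\<close>, and the
      second acquires the exponent \<open>a + p\<close> of \<open>Y\<close>.\<close>
    have FXY: "(\<integral>\<^sup>+v\<in>\<Omega>. F v * ennreal (\<delta> v powr a) \<partial>lborel) = ennreal e * X + ennreal C1 * Y"
    proof -
      have "(\<integral>\<^sup>+v\<in>\<Omega>. F v * ennreal (\<delta> v powr a) \<partial>lborel) =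
        (\<integral>\<^sup>+v. ennreal e * (ennreal (\<delta> v powr a) * (ennreal (h v powr p) * indicator \<Omega> v))
           + ennreal C1 * (ennreal (norm (deriv g v) powr p * \<delta> v powr (a + p)) * indicator \<Omega> v) \<partial>lborel)"
        by (intro nn_integral_cong)
          (auto simp: F_def indicator_def distrib_right distrib_left powr_add ennreal_mult mult_ac)
      also have "\<dots> = (\<integral>\<^sup>+v. ennreal e * (ennreal (\<delta> v powr a) * (ennreal (h v powr p) * indicator \<Omega> v)) \<partial>lborel)
           + (\<integral>\<^sup>+v. ennreal C1 * (ennreal (norm (deriv g v) powr p * \<delta> v powr (a + p)) * indicator \<Omega> v) \<partial>lborel)"
        by (rule nn_integral_add) measurable
      also have "(\<integral>\<^sup>+v. ennreal e * (ennreal (\<delta> v powr a) * (ennreal (h v powr p) * indicator \<Omega> v)) \<partial>lborel)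
          = ennreal e * (\<integral>\<^sup>+v. (ennreal (\<delta> v powr a) * (ennreal (h v powr p) * indicator \<Omega> v)) \<partial>lborel)"
        by (rule nn_integral_cmult) measurable
      also have "(\<integral>\<^sup>+v. (ennreal (\<delta> v powr a) * (ennreal (h v powr p) * indicator \<Omega> v)) \<partial>lborel) = X"
        unfolding X_def by (intro nn_integral_cong) (auto simp: ennreal_mult mult_ac)
      also have "(\<integral>\<^sup>+v. ennreal C1 * (ennreal (norm (deriv g v) powr p * \<delta> v powr (a + p)) * indicator \<Omega> v) \<partial>lborel) = ennreal C1 * Y"
        unfolding Y_def weighted_norm_def by (rule nn_integral_cmult) measurable
      finally show ?thesis .
    qed
    have "X \<le> (\<integral>\<^sup>+z. ennreal (norm (g x0) powr p) * (ennreal (\<delta> z powr a) * indicator \<Omega> z)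
        + ennreal c2 * (ennreal (\<delta> z powr a) * I z * indicator \<Omega> z) \<partial>lborel)"
      unfolding X_def
    proof (rule nn_integral_mono)
      fix z
      show "ennreal (h z powr p * \<delta> z powr a) * indicator \<Omega> z \<le> ennreal (norm (g x0) powr p) * (ennreal (\<delta> z powr a) * indicator \<Omega> z)
        + ennreal c2 * (ennreal (\<delta> z powr a) * I z * indicator \<Omega> z)"
      proof (cases "z \<in> \<Omega>")
        case True
        have "ennreal (h z powr p * \<delta> z powr a) \<le> (ennreal (norm (g x0) powr p) + ennreal c2 * I z) * ennreal (\<delta> z powr a)"
          by (simp add: ennreal_mult mult_right_mono pointwise[OF True])
        then show ?thesis using True by (simp add: distrib_left mult_ac)
      qed simp
    qed
    also have "\<dots> = (\<integral>\<^sup>+z. ennreal (norm (g x0) powr p) * (ennreal (\<delta> z powr a) * indicator \<Omega> z) \<partial>lborel)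
        + (\<integral>\<^sup>+z. ennreal c2 * (ennreal (\<delta> z powr a) * I z * indicator \<Omega> z) \<partial>lborel)"
      by (rule nn_integral_add) measurable
    also have "(\<integral>\<^sup>+z. ennreal (norm (g x0) powr p) * (ennreal (\<delta> z powr a) * indicator \<Omega> z) \<partial>lborel)
        = ennreal (norm (g x0) powr p) * ennreal m"
      by (subst nn_integral_cmult) (auto simp: m)
    also have "(\<integral>\<^sup>+z. ennreal c2 * (ennreal (\<delta> z powr a) * I z * indicator \<Omega> z) \<partial>lborel)
        = ennreal c2 * (\<integral>\<^sup>+z\<in>\<Omega>. ennreal (\<delta> z powr a) * I z \<partial>lborel)"
      by (rule nn_integral_cmult) measurable
    also have "(\<integral>\<^sup>+z\<in>\<Omega>. ennreal (\<delta> z powr a) * I z \<partial>lborel)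
        \<le> ennreal CK * (\<integral>\<^sup>+v\<in>\<Omega>. F v * ennreal (\<delta> v powr a) \<partial>lborel)"
      unfolding I_def B_def using F_meas CK(2,1) by (rule shadow_Fubini)
    finally have "X \<le> ennreal (norm (g x0) powr p) * ennreal m + ennreal c2 * (ennreal CK * (ennreal e * X + ennreal C1 * Y))"
      by (simp add: FXY add_left_mono mult_left_mono)
    also have "\<dots> = (ennreal m * ennreal (norm (g x0) powr p) + ennreal (c2 * CK * C1) * Y) + ennreal (c2 * CK * e) * X"
      using \<open>0 \<le> c2\<close> CK(1) \<open>0 < e\<close> \<open>0 \<le> C1\<close>
      by (simp add: ennreal_mult distrib_left mult_ac add_ac)
    also have "\<dots> \<le> (ennreal m * ennreal (norm (g x0) powr p) + ennreal (c2 * CK * C1) * Y) + ennreal (1 / 2) * X"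
      using \<open>c2 * CK * e \<le> 1 / 2\<close> by (intro add_left_mono mult_right_mono ennreal_leI) auto
    finally have "X \<le> 2 * (ennreal m * ennreal (norm (g x0) powr p) + ennreal (c2 * CK * C1) * Y)"
      using X_fin by (rule ennreal_absorb_half)
    also have "\<dots> = ennreal (2 * m) * ennreal (norm (g x0) powr p) + ennreal (2 * (c2 * CK * C1)) * Y"
      using m \<open>0 \<le> c2\<close> CK(1) \<open>0 \<le> C1\<close> by (simp add: ennreal_mult distrib_left mult.assoc)
    also have "\<dots> \<le> ennreal Ct * ennreal (norm (g x0) powr p) + ennreal Ct * Y"
      by (intro add_mono mult_right_mono ennreal_leI) (auto simp: Ct_def)
    finally show ?thesis by (simp add: X_def h_def Y_def distrib_left)
  qed
  have "weighted_norm a p g \<le> ennreal Ct * (ennreal (norm (g x0) powr p) + weighted_norm (a + p) p (deriv g))"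
    if g: "g holomorphic_on \<Omega>" for g
  proof -
    \<comment> \<open>\<open>Ct\<close> does not depend on \<open>N\<close>, so monotone convergence
      removes the truncation. At each point the supremum is reached once \<open>n\<close> exceeds
      \<open>norm (g z)\<close>.\<close>
    let ?f = "\<lambda>n z. ennreal (min (norm (g z)) (real n) powr p * \<delta> z powr a) * indicator \<Omega> z"
    have "ennreal (norm (g z) powr p * \<delta> z powr a) * indicator \<Omega> z \<le> (SUP n. ?f n z)" for z
    proof -
      obtain n where "norm (g z) \<le> real n" using real_arch_simple by blast
      then have "ennreal (norm (g z) powr p * \<delta> z powr a) * indicator \<Omega> z = ?f n z"
        by (simp add: min_def)
      also have "\<dots> \<le> (SUP n. ?f n z)" by (rule SUP_upper) simp
      finally show ?thesis .
    qed
    then have "weighted_norm a p g \<le> (\<integral>\<^sup>+z. (SUP n. ?f n z) \<partial>lborel)"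
      unfolding weighted_norm_def by (intro nn_integral_mono)
    also have "\<dots> = (SUP n. \<integral>\<^sup>+z. ?f n z \<partial>lborel)"
    proof (rule nn_integral_monotone_convergence_SUP)
      show "incseq ?f"
        using \<open>1 \<le> p\<close>
        by (auto simp: incseq_def le_fun_def intro!: mult_right_mono ennreal_leI powr_mono2)
      show "?f n \<in> borel_measurable lborel" for n
      proof -
        have "(\<lambda>v. ennreal (min (norm (indicator \<Omega> v *\<^sub>R g v)) (real n) powr p * \<delta> v powr a) * indicator \<Omega> v) \<in> borel_measurable lborel"
          using holomorphic_measurable[OF g] by measurable
        also have "(\<lambda>v. ennreal (min (norm (indicator \<Omega> v *\<^sub>R g v)) (real n) powr p * \<delta> v powr a) * indicator \<Omega> v) = ?f n"
          by (auto simp: indicator_def)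
        finally show ?thesis .
      qed
    qed
    also have "\<dots> \<le> ennreal Ct * (ennreal (norm (g x0) powr p) + weighted_norm (a + p) p (deriv g))"
      using main[OF g] by (intro SUP_least) auto
    finally show ?thesis .
  qed
  then show ?thesis using \<open>0 \<le> Ct\<close> by blast
qed

section \<open>Moving the base point\<close>

text \<open>Here the derivative bound is used with the weight exponent \<open>a + p\<close>. On one
  fixed disc \<open>\<delta>\<close> is comparable to \<open>\<delta> w\<close>, so changing the
  exponent costs a constant that may depend on \<open>w\<close> but not on \<open>g\<close>.\<close>

lemma local_norm_comparison:
  assumes "1 \<le> p" and w: "w \<in> \<Omega>"
  obtains C where "1 \<le> C"
    "\<And>g x y. g holomorphic_on \<Omega> \<Longrightarrow> x \<in> cball w (\<delta> w / 8) \<Longrightarrow> y \<in> cball w (\<delta> w / 8) \<Longrightarrow>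
      ennreal (norm (g x) powr p) \<le> ennreal C * (ennreal (norm (g y) powr p) + weighted_norm (a + p) p (deriv g))"
proof -
  define D where "D = \<delta> w"
  have "0 < D" using \<delta>_pos w by (simp add: D_def)
  \<comment> \<open>The three factors undo the area of the disc, repeat the constant of
    \<open>local_derivative_bound\<close>, and bound \<open>\<delta> v powr (- a)\<close> on the
    disc.\<close>
  define A where "A = 64 / (pi * D\<^sup>2) * (1024 * 4 powr p) * (2 powr \<bar>a\<bar> * D powr (- a))"
  have "0 \<le> A" by (simp add: A_def)
  define C where "C = 2 powr p * (1 + A)"
  have "1 \<le> 2 powr p" using \<open>1 \<le> p\<close> by (simp add: ge_one_powr_ge_zero)
  then have "1 \<le> C" using \<open>0 \<le> A\<close> mult_mono[of 1 "2 powr p" 1 "1 + A"] by (simp add: C_def)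
  moreover have "ennreal (norm (g x) powr p) \<le> ennreal C * (ennreal (norm (g y) powr p) + weighted_norm (a + p) p (deriv g))"
    if g: "g holomorphic_on \<Omega>" and xy: "x \<in> cball w (\<delta> w / 8)" "y \<in> cball w (\<delta> w / 8)" for g x y
  proof -
    let ?Y = "weighted_norm (a + p) p (deriv g)"
    obtain S where "0 \<le> S"
      and lip: "\<And>x y. x \<in> cball w (D / 8) \<Longrightarrow> y \<in> cball w (D / 8) \<Longrightarrow> norm (g x - g y) \<le> norm (x - y) * (S / D)"
      and S_le: "ennreal (S powr p) * ennreal (pi * D\<^sup>2 / 64)
      \<le> (\<integral>\<^sup>+v\<in>ball w (D / 4). ennreal (1024 * 4 powr p) * ennreal (norm (deriv g v) powr p * \<delta> v powr p) \<partial>lborel)"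
      using local_derivative_bound[OF g \<open>1 \<le> p\<close> w] unfolding D_def by blast
    have "norm (g x) \<le> norm (g y) + S"
    proof -
      have "norm (g x - g y) \<le> norm (x - y) * (S / D)" using xy by (intro lip) (auto simp: D_def)
      also have "\<dots> \<le> D * (S / D)"
        using xy \<open>0 < D\<close> \<open>0 \<le> S\<close> dist_triangle2[of x y w]
        by (intro mult_right_mono) (auto simp: dist_norm norm_minus_commute D_def)
      finally show ?thesis using norm_triangle_ineq2[of "g x" "g y"] \<open>0 < D\<close> by simp
    qed
    then have "norm (g x) powr p \<le> (2 * max (norm (g y)) S) powr p"
      using \<open>1 \<le> p\<close> by (intro powr_mono2) auto
    also have "\<dots> = 2 powr p * max (norm (g y)) S powr p" by (rule powr_mult)
    also have "\<dots> \<le> 2 powr p * (norm (g y) powr p + S powr p)"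
      by (intro mult_left_mono) (auto simp: max_def)
    finally have "ennreal (norm (g x) powr p) \<le> ennreal (2 powr p * (norm (g y) powr p + S powr p))"
      by (rule ennreal_leI)
    also have "\<dots> = ennreal (2 powr p) * (ennreal (norm (g y) powr p) + ennreal (S powr p))"
      by (simp add: ennreal_mult)
    finally have gx: "ennreal (norm (g x) powr p) \<le> ennreal (2 powr p) * (ennreal (norm (g y) powr p) + ennreal (S powr p))" .
    have "(\<integral>\<^sup>+v\<in>ball w (D / 4). ennreal (1024 * 4 powr p) * ennreal (norm (deriv g v) powr p * \<delta> v powr p) \<partial>lborel)
       \<le> (\<integral>\<^sup>+v. ennreal (1024 * 4 powr p * (2 powr \<bar>a\<bar> * D powr (- a))) * (ennreal (norm (deriv g v) powr p * \<delta> v powr (a + p)) * indicator \<Omega> v) \<partial>lborel)"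
    proof (rule nn_integral_mono)
      fix v
      show "ennreal (1024 * 4 powr p) * ennreal (norm (deriv g v) powr p * \<delta> v powr p) * indicator (ball w (D / 4)) v
        \<le> ennreal (1024 * 4 powr p * (2 powr \<bar>a\<bar> * D powr (- a))) * (ennreal (norm (deriv g v) powr p * \<delta> v powr (a + p)) * indicator \<Omega> v)"
      proof (cases "v \<in> ball w (D / 4)")
        case True
        then have v: "v \<in> \<Omega>" "\<delta> v \<le> 5 / 4 * D" "D \<le> 4 / 3 * \<delta> v"
          using \<delta>_comparable[OF w, of v] by (auto simp: D_def)
        have "0 < \<delta> v" using v \<delta>_pos by auto
        have "\<delta> v powr p = \<delta> v powr (- a) * \<delta> v powr (a + p)"
          by (simp flip: powr_add)
        also have "\<dots> \<le> (2 powr \<bar>a\<bar> * D powr (- a)) * \<delta> v powr (a + p)"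
          using powr_comparable[of D "\<delta> v" "- a"] v \<open>0 < D\<close> \<open>0 < \<delta> v\<close> by (intro mult_right_mono) auto
        finally have "1024 * 4 powr p * norm (deriv g v) powr p * \<delta> v powr p
          \<le> 1024 * 4 powr p * norm (deriv g v) powr p * ((2 powr \<bar>a\<bar> * D powr (- a)) * \<delta> v powr (a + p))"
          by (intro mult_left_mono) auto
        then show ?thesis using True v
          by (auto simp: mult_ac simp flip: ennreal_mult intro!: ennreal_leI)
      qed simp
    qed
    also have "\<dots> = ennreal (1024 * 4 powr p * (2 powr \<bar>a\<bar> * D powr (- a))) * ?Y"
      unfolding weighted_norm_def
      using weighted_measurable[OF holomorphic_deriv[OF g open_\<Omega>]] by (intro nn_integral_cmult) simp
    finally have "ennreal (S powr p) * ennreal (pi * D\<^sup>2 / 64) \<le> ennreal (1024 * 4 powr p * (2 powr \<bar>a\<bar> * D powr (- a))) * ?Y"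
      by (rule order_trans[OF S_le])
    then have "ennreal (64 / (pi * D\<^sup>2)) * (ennreal (S powr p) * ennreal (pi * D\<^sup>2 / 64))
       \<le> ennreal (64 / (pi * D\<^sup>2)) * (ennreal (1024 * 4 powr p * (2 powr \<bar>a\<bar> * D powr (- a))) * ?Y)"
      by (rule mult_left_mono) simp
    also have "\<dots> = ennreal A * ?Y"
    proof -
      have "ennreal A = ennreal (64 / (pi * D\<^sup>2)) * ennreal (1024 * 4 powr p * (2 powr \<bar>a\<bar> * D powr (- a)))"
        unfolding A_def by (subst ennreal_mult[symmetric]) (auto simp: mult.assoc)
      then show ?thesis by (simp only: mult.assoc)
    qed
    also have "ennreal (64 / (pi * D\<^sup>2)) * (ennreal (S powr p) * ennreal (pi * D\<^sup>2 / 64)) = ennreal (S powr p)"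
      using \<open>0 < D\<close> by (simp flip: ennreal_mult)
    finally have "ennreal (S powr p) \<le> ennreal A * ?Y" .
    then have "ennreal (2 powr p) * (ennreal (norm (g y) powr p) + ennreal (S powr p))
      \<le> ennreal (2 powr p) * (ennreal (1 + A) * ennreal (norm (g y) powr p) + ennreal (1 + A) * ?Y)"
    proof (intro mult_left_mono add_mono)
      show "ennreal (norm (g y) powr p) \<le> ennreal (1 + A) * ennreal (norm (g y) powr p)"
        using \<open>0 \<le> A\<close> by (simp flip: ennreal_mult add: distrib_right)
      assume "ennreal (S powr p) \<le> ennreal A * ?Y"
      also have "\<dots> \<le> ennreal (1 + A) * ?Y" using \<open>0 \<le> A\<close> by (intro mult_right_mono ennreal_leI) auto
      finally show "ennreal (S powr p) \<le> ennreal (1 + A) * ?Y" .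
    qed simp
    also have "\<dots> = ennreal C * (ennreal (norm (g y) powr p) + ?Y)"
    proof -
      have "ennreal C = ennreal (2 powr p) * ennreal (1 + A)"
        unfolding C_def using \<open>0 \<le> A\<close> by (intro ennreal_mult) auto
      then show ?thesis by (simp only: distrib_left mult.assoc)
    qed
    finally show ?thesis using gx by (rule order_trans[rotated])
  qed
  ultimately show thesis by (rule that)
qed

text \<open>The estimate composes along chains of points and holds in both directions on small
  discs, so connectedness spreads it to all pairs.\<close>

lemma center_change:
  assumes "connected \<Omega>" "1 \<le> p" "x \<in> \<Omega>" "y \<in> \<Omega>"
  shows "\<exists>C\<ge>1. \<forall>g. g holomorphic_on \<Omega> \<longrightarrow>
      ennreal (norm (g x) powr p) \<le> ennreal C * (ennreal (norm (g y) powr p) + weighted_norm (a + p) p (deriv g))"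
proof -
  define R where "R x y \<longleftrightarrow> (\<exists>C\<ge>1. \<forall>g. g holomorphic_on \<Omega> \<longrightarrow>
      ennreal (norm (g x) powr p) \<le> ennreal C * (ennreal (norm (g y) powr p) + weighted_norm (a + p) p (deriv g)))" for x y
  have trans: "R x z" if xy: "R x y" and yz: "R y z" for x y z
  proof -
    obtain C1 where C1: "1 \<le> C1" "\<And>g. g holomorphic_on \<Omega> \<Longrightarrow>
      ennreal (norm (g x) powr p) \<le> ennreal C1 * (ennreal (norm (g y) powr p) + weighted_norm (a + p) p (deriv g))"
      using xy unfolding R_def by blast
    obtain C2 where C2: "1 \<le> C2" "\<And>g. g holomorphic_on \<Omega> \<Longrightarrow>
      ennreal (norm (g y) powr p) \<le> ennreal C2 * (ennreal (norm (g z) powr p) + weighted_norm (a + p) p (deriv g))"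
      using yz unfolding R_def by blast
    have "ennreal (norm (g x) powr p) \<le> ennreal (C1 * (C2 + 1)) * (ennreal (norm (g z) powr p) + weighted_norm (a + p) p (deriv g))"
      if g: "g holomorphic_on \<Omega>" for g
    proof -
      let ?Y = "weighted_norm (a + p) p (deriv g)" and ?z = "ennreal (norm (g z) powr p)"
      have "ennreal (norm (g x) powr p) \<le> ennreal C1 * (ennreal (norm (g y) powr p) + ?Y)"
        by (rule C1(2)[OF g])
      \<comment> \<open>\<open>?Y\<close> enters from both estimates; the second copy accounts for
        the 1 in \<open>C2 + 1\<close>.\<close>
      also have "\<dots> \<le> ennreal C1 * (ennreal C2 * (?z + ?Y) + ennreal 1 * (?z + ?Y))"
        using C2(2)[OF g] by (intro mult_left_mono add_mono) auto
      also have "\<dots> = ennreal (C1 * (C2 + 1)) * (?z + ?Y)"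
        using C1(1) C2(1) by (simp add: ennreal_mult distrib_right distrib_left mult.assoc)
      finally show ?thesis .
    qed
    moreover have "1 \<le> C1 * (C2 + 1)" using C1(1) C2(1) mult_mono[of 1 C1 1 "C2 + 1"] by simp
    ultimately show ?thesis unfolding R_def by blast
  qed
  have "R x y \<and> R y x"
    using \<open>connected \<Omega>\<close> \<open>x \<in> \<Omega>\<close> \<open>y \<in> \<Omega>\<close>
  proof (rule connected_equivalence_relation)
    show "\<exists>T. openin (top_of_set \<Omega>) T \<and> w \<in> T \<and> (\<forall>x\<in>T. R w x \<and> R x w)" if w: "w \<in> \<Omega>" for w
    proof (intro exI conjI ballI)
      have "0 < \<delta> w" using \<delta>_pos w by simp
      have "ball w (\<delta> w / 8) \<subseteq> \<Omega>"
        using \<delta>_comparable(1)[OF w] \<open>0 < \<delta> w\<close> by auto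
      then show "openin (top_of_set \<Omega>) (ball w (\<delta> w / 8))"
        by (intro open_openin_trans[OF open_\<Omega>]) auto
      show "w \<in> ball w (\<delta> w / 8)" using \<open>0 < \<delta> w\<close> by simp
      obtain C where C: "1 \<le> C"
        "\<And>g x y. g holomorphic_on \<Omega> \<Longrightarrow> x \<in> cball w (\<delta> w / 8) \<Longrightarrow> y \<in> cball w (\<delta> w / 8) \<Longrightarrow>
        ennreal (norm (g x) powr p) \<le> ennreal C * (ennreal (norm (g y) powr p) + weighted_norm (a + p) p (deriv g))"
        using local_norm_comparison[OF \<open>1 \<le> p\<close> w] by blast
      have loc: "R x y" if "x \<in> cball w (\<delta> w / 8)" "y \<in> cball w (\<delta> w / 8)" for x y
        unfolding R_def using C that by blast
      show "R w x" "R x w" if "x \<in> ball w (\<delta> w / 8)" for x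
        using that \<open>0 < \<delta> w\<close> by (auto intro!: loc)
    qed
  qed (use trans in blast)+
  then show ?thesis by (simp add: R_def)
qed

section \<open>The upper estimate\<close>

text \<open>The sub-mean value inequality on a single disc, where the weight is bounded below by a
  positive constant depending on \<open>z\<close>.\<close>

lemma point_bound:
  assumes "1 \<le> p" and z: "z \<in> \<Omega>"
  shows "\<exists>C\<ge>0. \<forall>g. g holomorphic_on \<Omega> \<longrightarrow> ennreal (norm (g z) powr p) \<le> ennreal C * weighted_norm a p g"
proof -
  define D where "D = \<delta> z"
  have "0 < D" using \<delta>_pos z by (simp add: D_def)
  define A where "A = 2 powr \<bar>a\<bar> * D powr (- a)"
  define r where "r = D / 8"
  define C where "C = 1 / (pi * r\<^sup>2) * (1024 * 2 powr p * A)"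
  have "0 \<le> A" "0 < r" "0 \<le> C" using \<open>0 < D\<close> by (auto simp: A_def C_def r_def)
  have sub: "cball z r \<subseteq> \<Omega>"
  proof
    fix v assume "v \<in> cball z r"
    then show "v \<in> \<Omega>" using \<delta>_comparable(1)[OF z, of v] \<open>0 < D\<close> by (simp add: D_def r_def)
  qed
  have "ennreal (norm (g z) powr p) \<le> ennreal C * weighted_norm a p g" if g: "g holomorphic_on \<Omega>" for g
  proof -
    have "ennreal (norm (g z) powr p * (pi * r\<^sup>2))
        \<le> ennreal (1024 * 2 powr p) * (\<integral>\<^sup>+v\<in>ball z r. ennreal (norm (g v) powr p) \<partial>lborel)"
      using open_\<Omega> g sub \<open>0 < r\<close> \<open>1 \<le> p\<close> by (rule powr_submean_value)
    also have "(\<integral>\<^sup>+v\<in>ball z r. ennreal (norm (g v) powr p) \<partial>lborel)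
       \<le> (\<integral>\<^sup>+v. ennreal A * (ennreal (norm (g v) powr p * \<delta> v powr a) * indicator \<Omega> v) \<partial>lborel)"
    proof (rule nn_integral_mono)
      fix v
      show "ennreal (norm (g v) powr p) * indicator (ball z r) v
        \<le> ennreal A * (ennreal (norm (g v) powr p * \<delta> v powr a) * indicator \<Omega> v)"
      proof (cases "v \<in> ball z r")
        case True
        then have v: "v \<in> \<Omega>" "\<delta> v \<le> 5 / 4 * D" "D \<le> 4 / 3 * \<delta> v"
          using \<delta>_comparable[OF z, of v] \<open>0 < D\<close> by (auto simp: D_def r_def)
        have "0 < \<delta> v" using v \<delta>_pos by auto
        have "1 = \<delta> v powr (- a) * \<delta> v powr a" using \<open>0 < \<delta> v\<close> by (simp flip: powr_add)
        also have "\<dots> \<le> A * \<delta> v powr a"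
          using powr_comparable[of D "\<delta> v" "- a"] v \<open>0 < D\<close> \<open>0 < \<delta> v\<close>
          by (intro mult_right_mono) (auto simp: A_def)
        finally have "norm (g v) powr p * 1 \<le> norm (g v) powr p * (A * \<delta> v powr a)"
          by (rule mult_left_mono) simp
        then show ?thesis using True v \<open>0 \<le> A\<close>
          by (auto simp: mult_ac simp flip: ennreal_mult intro!: ennreal_leI)
      qed simp
    qed
    also have "\<dots> = ennreal A * weighted_norm a p g"
      unfolding weighted_norm_def
      using weighted_measurable[OF g] by (intro nn_integral_cmult) simp
    finally have "ennreal (norm (g z) powr p * (pi * r\<^sup>2)) \<le> ennreal (1024 * 2 powr p) * (ennreal A * weighted_norm a p g)"
      by (simp add: mult_left_mono)
    then have "ennreal (1 / (pi * r\<^sup>2)) * ennreal (norm (g z) powr p * (pi * r\<^sup>2))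
        \<le> ennreal (1 / (pi * r\<^sup>2)) * (ennreal (1024 * 2 powr p) * (ennreal A * weighted_norm a p g))"
      by (rule mult_left_mono) simp
    also have "ennreal (1 / (pi * r\<^sup>2)) * ennreal (norm (g z) powr p * (pi * r\<^sup>2)) = ennreal (norm (g z) powr p)"
      using \<open>0 < r\<close> by (simp flip: ennreal_mult)
    also have "ennreal (1 / (pi * r\<^sup>2)) * (ennreal (1024 * 2 powr p) * (ennreal A * weighted_norm a p g))
       = ennreal C * weighted_norm a p g"
      unfolding C_def using \<open>0 \<le> A\<close> by (subst (1 2) ennreal_mult) (auto simp: mult.assoc)
    finally show ?thesis .
  qed
  then show ?thesis using \<open>0 \<le> C\<close> by blast
qed

text \<open>Cauchy's estimate bounds \<open>deriv g z\<close> by the maximum of \<open>g\<close> on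
  a small disc, and the sub-mean value inequality at a maximum point \<open>u\<close> bounds that by
  an average. The right side has the shape of \<open>shadow_Fubini\<close> with \<open>K\<close>
  equal to 1.\<close>

lemma norm_deriv_powr_bound:
  assumes g: "g holomorphic_on \<Omega>" and "1 \<le> p" and z: "z \<in> \<Omega>"
  shows "ennreal (norm (deriv g z) powr p * \<delta> z powr p)
    \<le> ennreal (16 powr p * (1024 * 2 powr p) * 256) *
       (\<integral>\<^sup>+v\<in>{v\<in>\<Omega>. dist z v < 1 * \<delta> v}. ennreal (1 / (\<delta> v)\<^sup>2) * ennreal (norm (g v) powr p) \<partial>lborel)"
proof -
  define D where "D = \<delta> z"
  have "0 < D" using \<delta>_pos z by (simp add: D_def)
  define r where "r = D / 16"
  have "0 < r" using \<open>0 < D\<close> by (simp add: r_def)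
  have sub: "cball z r \<subseteq> \<Omega>"
  proof
    fix v assume "v \<in> cball z r"
    then show "v \<in> \<Omega>" using \<delta>_comparable(1)[OF z, of v] \<open>0 < D\<close> by (simp add: D_def r_def)
  qed
  have contg: "continuous_on (cball z r) g"
    using g sub holomorphic_on_imp_continuous_on continuous_on_subset by blast
  obtain u where u: "u \<in> cball z r" and umax: "\<And>v. v \<in> cball z r \<Longrightarrow> norm (g v) \<le> norm (g u)"
    using continuous_attains_sup[of "cball z r" "\<lambda>v. norm (g v)"] \<open>0 < r\<close>
      continuous_on_norm[OF contg] by auto
  have "norm ((deriv ^^ 1) g z) \<le> fact 1 * norm (g u) / r ^ 1"
  proof (rule Cauchy_inequality)
    show "norm (g v) \<le> norm (g u)" if "norm (z - v) = r" for v
      using that by (intro umax) (simp add: dist_norm)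
    show "g holomorphic_on ball z r"
      using g sub ball_subset_cball[of z r] by (meson holomorphic_on_subset)
  qed (use contg \<open>0 < r\<close> in auto)
  then have "norm (deriv g z) * D \<le> 16 * norm (g u)"
    using \<open>0 < D\<close> by (simp add: r_def field_simps)
  then have "(norm (deriv g z) * D) powr p \<le> (16 * norm (g u)) powr p"
    using \<open>1 \<le> p\<close> \<open>0 < D\<close> by (intro powr_mono2) auto
  then have d1: "norm (deriv g z) powr p * D powr p \<le> 16 powr p * norm (g u) powr p"
    by (simp only: powr_mult)
  have uv: "dist z v < D / 4" if "dist u v < r" for v
    using that u dist_triangle[of z v u] \<open>0 < D\<close> by (simp add: r_def)
  have "cball u r \<subseteq> \<Omega>"
  proof
    fix v assume "v \<in> cball u r"
    then show "v \<in> \<Omega>" using \<delta>_comparable(1)[OF z, of v] u dist_triangle[of z v u] \<open>0 < D\<close>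
      by (simp add: r_def D_def)
  qed
  then have "ennreal (norm (g u) powr p * (pi * r\<^sup>2))
      \<le> ennreal (1024 * 2 powr p) * (\<integral>\<^sup>+v\<in>ball u r. ennreal (norm (g v) powr p) \<partial>lborel)"
    using open_\<Omega> g \<open>0 < r\<close> \<open>1 \<le> p\<close> by (intro powr_submean_value) auto
  also have "(\<integral>\<^sup>+v\<in>ball u r. ennreal (norm (g v) powr p) \<partial>lborel)
    \<le> (\<integral>\<^sup>+v. ennreal (2 * D\<^sup>2) * (ennreal (1 / (\<delta> v)\<^sup>2) * ennreal (norm (g v) powr p) * indicator {v\<in>\<Omega>. dist z v < 1 * \<delta> v} v) \<partial>lborel)"
  proof (rule nn_integral_mono)
    fix v
    show "ennreal (norm (g v) powr p) * indicator (ball u r) v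
      \<le> ennreal (2 * D\<^sup>2) * (ennreal (1 / (\<delta> v)\<^sup>2) * ennreal (norm (g v) powr p) * indicator {v\<in>\<Omega>. dist z v < 1 * \<delta> v} v)"
    proof (cases "v \<in> ball u r")
      case True
      then have "dist z v < \<delta> z / 4" using uv by (simp add: D_def)
      then have v: "v \<in> \<Omega>" "\<delta> v \<le> 5 / 4 * D" "D \<le> 4 / 3 * \<delta> v"
        using \<delta>_comparable[OF z, of v] by (auto simp: D_def)
      have "0 < \<delta> v" using v \<delta>_pos by auto
      have "dist z v < \<delta> v" using \<open>dist z v < \<delta> z / 4\<close> v \<open>0 < \<delta> v\<close> by (simp add: D_def)
      have "(\<delta> v)\<^sup>2 \<le> (5 / 4 * D)\<^sup>2" using v \<open>0 < \<delta> v\<close> by (intro power_mono) auto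
      also have "\<dots> \<le> 2 * D\<^sup>2" by (simp add: power_mult_distrib power_divide)
      finally have "1 \<le> 2 * D\<^sup>2 * (1 / (\<delta> v)\<^sup>2)" using \<open>0 < \<delta> v\<close> by (simp add: field_simps)
      then have "1 * norm (g v) powr p \<le> 2 * D\<^sup>2 * (1 / (\<delta> v)\<^sup>2) * norm (g v) powr p"
        by (rule mult_right_mono) simp
      then show ?thesis using True v \<open>dist z v < \<delta> v\<close>
        by (auto simp flip: ennreal_mult intro!: ennreal_leI)
    qed simp
  qed
  also have "\<dots> = ennreal (2 * D\<^sup>2) * (\<integral>\<^sup>+v\<in>{v\<in>\<Omega>. dist z v < 1 * \<delta> v}. ennreal (1 / (\<delta> v)\<^sup>2) * ennreal (norm (g v) powr p) \<partial>lborel)"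
  proof (rule nn_integral_cmult)
    have "(\<lambda>v. ennreal (1 / (\<delta> v)\<^sup>2) * ennreal (norm (indicator \<Omega> v *\<^sub>R g v) powr p) * (if v \<in> \<Omega> \<and> dist z v < \<delta> v then 1 else 0)) \<in> borel_measurable lborel"
      using holomorphic_measurable[OF g] by measurable
    also have "(\<lambda>v. ennreal (1 / (\<delta> v)\<^sup>2) * ennreal (norm (indicator \<Omega> v *\<^sub>R g v) powr p) * (if v \<in> \<Omega> \<and> dist z v < \<delta> v then 1 else 0))
      = (\<lambda>v. ennreal (1 / (\<delta> v)\<^sup>2) * ennreal (norm (g v) powr p) * indicator {v\<in>\<Omega>. dist z v < 1 * \<delta> v} v)"
      by (auto simp: indicator_def)
    finally show "(\<lambda>v. ennreal (1 / (\<delta> v)\<^sup>2) * ennreal (norm (g v) powr p) * indicator {v\<in>\<Omega>. dist z v < 1 * \<delta> v} v) \<in> borel_measurable lborel" .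
  qed
  finally have gu: "ennreal (norm (g u) powr p * (pi * r\<^sup>2)) \<le> ennreal (1024 * 2 powr p) * (ennreal (2 * D\<^sup>2) *
      (\<integral>\<^sup>+v\<in>{v\<in>\<Omega>. dist z v < 1 * \<delta> v}. ennreal (1 / (\<delta> v)\<^sup>2) * ennreal (norm (g v) powr p) \<partial>lborel))" (is "_ \<le> _ * (_ * ?J)")
    by (simp add: mult_left_mono)
  have "norm (g u) powr p = (1 / (pi * r\<^sup>2)) * (norm (g u) powr p * (pi * r\<^sup>2))"
    using \<open>0 < r\<close> by simp
  \<comment> \<open>With \<open>r = D / 16\<close> the reciprocal area is
    \<open>256 / (pi * D\<^sup>2)\<close>, and \<open>pi\<close> is rounded down to 2. The factor
    \<open>2 * D\<^sup>2\<close> in \<open>gu\<close> then cancels the denominator and leaves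
    256.\<close>
  also have "\<dots> \<le> (128 / D\<^sup>2) * (norm (g u) powr p * (pi * r\<^sup>2))"
  proof (rule mult_right_mono)
    have "256 / (pi * D\<^sup>2) \<le> 256 / (2 * D\<^sup>2)"
      using \<open>0 < D\<close> pi_gt3 by (intro divide_left_mono mult_right_mono) auto
    then show "1 / (pi * r\<^sup>2) \<le> 128 / D\<^sup>2" by (simp add: r_def power_divide)
  qed simp
  finally have "norm (deriv g z) powr p * D powr p \<le> 16 powr p * ((128 / D\<^sup>2) * (norm (g u) powr p * (pi * r\<^sup>2)))"
    using d1 by (meson mult_left_mono order_trans powr_ge_zero)
  then have "ennreal (norm (deriv g z) powr p * D powr p) \<le> ennreal (16 powr p * ((128 / D\<^sup>2) * (norm (g u) powr p * (pi * r\<^sup>2))))"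
    by (rule ennreal_leI)
  also have "\<dots> = ennreal (16 powr p * (128 / D\<^sup>2)) * ennreal (norm (g u) powr p * (pi * r\<^sup>2))"
    by (simp add: mult.assoc flip: ennreal_mult)
  also have "\<dots> \<le> ennreal (16 powr p * (128 / D\<^sup>2)) * (ennreal (1024 * 2 powr p) * (ennreal (2 * D\<^sup>2) * ?J))"
    using gu by (rule mult_left_mono) simp
  also have "\<dots> = (ennreal (16 powr p * (128 / D\<^sup>2)) * ennreal (1024 * 2 powr p) * ennreal (2 * D\<^sup>2)) * ?J"
    by (simp only: mult.assoc)
  also have "ennreal (16 powr p * (128 / D\<^sup>2)) * ennreal (1024 * 2 powr p) * ennreal (2 * D\<^sup>2)
      = ennreal (16 powr p * (1024 * 2 powr p) * 256)"
    using \<open>0 < D\<close> by (simp flip: ennreal_mult)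
  finally show ?thesis by (simp only: D_def)
qed

text \<open>The pointwise derivative bound is multiplied by \<open>\<delta> z powr a\<close> and
  integrated; \<open>shadow_Fubini\<close> with \<open>K\<close> equal to 1 restores the weight on
  the side of \<open>g\<close>.\<close>

lemma derivative_bound:
  assumes "shadow_condition a" "1 \<le> p"
  shows "\<exists>C\<ge>0. \<forall>g. g holomorphic_on \<Omega> \<longrightarrow> weighted_norm (a + p) p (deriv g) \<le> ennreal C * weighted_norm a p g"
proof -
  obtain CK where CK: "0 \<le> CK" "\<And>w. w \<in> \<Omega> \<Longrightarrow>
       (\<integral>\<^sup>+z\<in>{z\<in>\<Omega>. dist z w < 1 * \<delta> w}. ennreal (\<delta> z powr a) \<partial>lborel) \<le> ennreal (CK * \<delta> w powr (a + 2))"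
    using assms(1) unfolding shadow_condition_def by blast
  define c where "c = 16 powr p * (1024 * 2 powr p) * 256"
  have "weighted_norm (a + p) p (deriv g) \<le> ennreal (c * CK) * weighted_norm a p g" if g: "g holomorphic_on \<Omega>" for g
  proof -
    define F where "F v = ennreal (norm (indicator \<Omega> v *\<^sub>R g v) powr p)" for v
    have F [measurable]: "F \<in> borel_measurable borel"
      unfolding F_def using holomorphic_measurable[OF g] by measurable
    define I where "I z = (\<integral>\<^sup>+v\<in>{v\<in>\<Omega>. dist z v < 1 * \<delta> v}. ennreal (1 / (\<delta> v)\<^sup>2) * F v \<partial>lborel)" for z
    have [measurable]: "I \<in> borel_measurable borel"
    proof -
      have "I = (\<lambda>z. \<integral>\<^sup>+v. ennreal (1 / (\<delta> v)\<^sup>2) * F v * (if v \<in> \<Omega> \<and> dist z v < 1 * \<delta> v then 1 else 0) \<partial>lborel)"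
        by (intro ext) (simp add: I_def indicator_def of_bool_def)
      also have "\<dots> \<in> borel_measurable borel" by measurable
      finally show ?thesis .
    qed
    have I_eq: "I z = (\<integral>\<^sup>+v\<in>{v\<in>\<Omega>. dist z v < 1 * \<delta> v}. ennreal (1 / (\<delta> v)\<^sup>2) * ennreal (norm (g v) powr p) \<partial>lborel)" for z
      unfolding I_def F_def by (intro nn_integral_cong) (auto simp: indicator_def)
    have "weighted_norm (a + p) p (deriv g) \<le> (\<integral>\<^sup>+z. ennreal c * (ennreal (\<delta> z powr a) * I z * indicator \<Omega> z) \<partial>lborel)"
      unfolding weighted_norm_def
    proof (rule nn_integral_mono)
      fix z
      show "ennreal (norm (deriv g z) powr p * \<delta> z powr (a + p)) * indicator \<Omega> z
        \<le> ennreal c * (ennreal (\<delta> z powr a) * I z * indicator \<Omega> z)"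
      proof (cases "z \<in> \<Omega>")
        case True
        have "ennreal (norm (deriv g z) powr p * \<delta> z powr (a + p))
           = ennreal (\<delta> z powr a) * ennreal (norm (deriv g z) powr p * \<delta> z powr p)"
          by (simp add: powr_add mult_ac flip: ennreal_mult)
        also have "\<dots> \<le> ennreal (\<delta> z powr a) * (ennreal c * I z)"
          unfolding I_eq c_def by (intro mult_left_mono norm_deriv_powr_bound g True \<open>1 \<le> p\<close>) simp
        finally show ?thesis using True by (simp add: mult_ac)
      qed simp
    qed
    also have "\<dots> = ennreal c * (\<integral>\<^sup>+z\<in>\<Omega>. ennreal (\<delta> z powr a) * I z \<partial>lborel)"
      by (rule nn_integral_cmult) measurable
    also have "\<dots> \<le> ennreal c * (ennreal CK * (\<integral>\<^sup>+v\<in>\<Omega>. F v * ennreal (\<delta> v powr a) \<partial>lborel))"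
      unfolding I_def using F CK(2,1) by (intro mult_left_mono shadow_Fubini) auto
    also have "(\<integral>\<^sup>+v\<in>\<Omega>. F v * ennreal (\<delta> v powr a) \<partial>lborel) = weighted_norm a p g"
      unfolding weighted_norm_def F_def by (intro nn_integral_cong) (auto simp: indicator_def ennreal_mult)
    also have "ennreal c * (ennreal CK * weighted_norm a p g) = ennreal (c * CK) * weighted_norm a p g"
      using CK(1) by (simp add: c_def ennreal_mult mult.assoc)
    finally show ?thesis .
  qed
  moreover have "0 \<le> c * CK" using CK(1) by (simp add: c_def)
  ultimately show ?thesis by blast
qed

subsection \<open>Integrability of powers of the boundary distance\<close>

text \<open>On the region \<open>\<delta> z\<close> is at most \<open>(K + 1) * \<delta> w\<close>,
  and a nonnegative power preserves this bound; the area of the disc supplies the two extra powers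
  of \<open>\<delta> w\<close>.\<close>

lemma shadow_condition_nonneg:
  assumes "0 \<le> a"
  shows "shadow_condition a"
  unfolding shadow_condition_def
proof (intro allI impI)
  fix K :: real assume "1 \<le> K"
  define C where "C = (K + 1) powr a * (pi * K\<^sup>2)"
  have "(\<integral>\<^sup>+z\<in>{z\<in>\<Omega>. dist z w < K * \<delta> w}. ennreal (\<delta> z powr a) \<partial>lborel) \<le> ennreal (C * \<delta> w powr (a + 2))"
    if w: "w \<in> \<Omega>" for w
  proof -
    have "0 < \<delta> w" using w \<delta>_pos by simp
    have "(\<integral>\<^sup>+z\<in>{z\<in>\<Omega>. dist z w < K * \<delta> w}. ennreal (\<delta> z powr a) \<partial>lborel)
      \<le> (\<integral>\<^sup>+z\<in>ball w (K * \<delta> w). ennreal (((K + 1) * \<delta> w) powr a) \<partial>lborel)"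
    proof (rule nn_integral_mono)
      fix z
      have "\<delta> z powr a \<le> ((K + 1) * \<delta> w) powr a" if "dist z w < K * \<delta> w"
        using that \<delta>_lipschitz[of z w] \<delta>_nonneg[of z] assms by (intro powr_mono2) (auto simp: distrib_right)
      then show "ennreal (\<delta> z powr a) * indicator {z\<in>\<Omega>. dist z w < K * \<delta> w} z
        \<le> ennreal (((K + 1) * \<delta> w) powr a) * indicator (ball w (K * \<delta> w)) z"
        by (auto simp: indicator_def dist_commute intro!: ennreal_leI)
    qed
    also have "\<dots> = ennreal (((K + 1) * \<delta> w) powr a * (pi * (K * \<delta> w)\<^sup>2))"
      using \<open>0 < \<delta> w\<close> \<open>1 \<le> K\<close>
      by (subst nn_integral_cmult_indicator) (auto simp: emeasure_ball unit_ball_vol_2 ennreal_mult)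
    also have "((K + 1) * \<delta> w) powr a * (pi * (K * \<delta> w)\<^sup>2) = C * \<delta> w powr (a + 2)"
      using \<open>0 < \<delta> w\<close> by (simp add: C_def powr_mult powr_add power_mult_distrib)
    finally show ?thesis .
  qed
  moreover have "0 \<le> C" by (simp add: C_def)
  ultimately show "\<exists>C\<ge>0. \<forall>w\<in>\<Omega>.
     (\<integral>\<^sup>+z\<in>{z\<in>\<Omega>. dist z w < K * \<delta> w}. ennreal (\<delta> z powr a) \<partial>lborel) \<le> ennreal (C * \<delta> w powr (a + 2))"
    by blast
qed

text \<open>Where \<open>R/2\<^sup>j\<^sup>+\<^sup>1 < \<delta> \<le> R/2\<^sup>j\<close>, doubling the covering discs of radius \<open>R/2\<^sup>j\<close> of the boundary covers
  the point, so the layers contribute a geometric series of ratio \<open>q\<close>.\<close>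

lemma shadow_condition_neg:
  assumes "a < 0" "s < a + 2"
    and "0 < C0" and cover: "\<And>x R r. x \<in> frontier \<Omega> \<Longrightarrow> 0 < r \<Longrightarrow> r < R \<Longrightarrow>
      ereal_of_enat (covering_number r (frontier \<Omega> \<inter> ball x R)) \<le> ereal (C0 * (R / r) powr s)"
  shows "shadow_condition a"
  unfolding shadow_condition_def
proof (intro allI impI)
  fix K :: real assume "1 \<le> K"
  \<comment> \<open>From layer \<open>j\<close> to the next, the bound on the number of discs grows
    by \<open>2 powr s\<close>, the area of each shrinks by \<open>2 powr (- 2)\<close>, and the
    weight changes by \<open>2 powr (- a)\<close>.\<close>
  define q where "q = 2 powr (s - a - 2)"
  have q: "0 < q" "q < 1" using assms by (auto simp: q_def powr_less_one)
  \<comment> \<open>The factors come from the covering bound at radius ratio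
    \<open>3 * 2 ^ j\<close>, the area of a doubled disc, and the weight at the inner edge
    \<open>R / 2 ^ Suc j\<close> of a layer.\<close>
  define C1 where "C1 = C0 * 3 powr s * (4 * pi) * 2 powr (- a)"
  have "0 \<le> C1" using \<open>0 < C0\<close> by (simp add: C1_def)
  define C where "C = C1 / (1 - q) * (K + 1) powr (a + 2)"
  have "(\<integral>\<^sup>+z\<in>{z\<in>\<Omega>. dist z w < K * \<delta> w}. ennreal (\<delta> z powr a) \<partial>lborel) \<le> ennreal (C * \<delta> w powr (a + 2))"
    if w: "w \<in> \<Omega>" for w
  proof -
    have "0 < \<delta> w" using w \<delta>_pos by simp
    define R where "R = (K + 1) * \<delta> w"
    have "0 < R" using \<open>0 < \<delta> w\<close> \<open>1 \<le> K\<close> by (simp add: R_def)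
    obtain x where x: "x \<in> frontier \<Omega>" "\<delta> w = dist w x"
      using infdist_attains_inf[OF frontier_closed frontier_nonempty] by (metis bdist_def)
    \<comment> \<open>The boundary points nearest to points of the region lie within
      \<open>3 * R\<close> of \<open>x\<close>; moreover \<open>R / 2 ^ j < 3 * R\<close> is strict
      even for \<open>j = 0\<close>, as \<open>cover\<close> demands.\<close>
    have "\<exists>T. finite T \<and> frontier \<Omega> \<inter> ball x (3 * R) \<subseteq> (\<Union>c\<in>T. ball c (R / 2 ^ j)) \<and>
        real (card T) \<le> C0 * (3 * 2 ^ j) powr s" for j :: nat
    proof -
      have "1 \<le> (2::real) ^ j" by simp
      then have "R / 2 ^ j \<le> R / 1" using \<open>0 < R\<close> by (intro divide_left_mono) auto
      then have "R / 2 ^ j < 3 * R" using \<open>0 < R\<close> by simp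
      moreover have "3 * R / (R / 2 ^ j) = 3 * 2 ^ j" using \<open>0 < R\<close> by simp
      ultimately have "ereal_of_enat (covering_number (R / 2 ^ j) (frontier \<Omega> \<inter> ball x (3 * R)))
          \<le> ereal (C0 * (3 * 2 ^ j) powr s)"
        using cover[OF x(1), of "R / 2 ^ j" "3 * R"] \<open>0 < R\<close> by simp
      then show ?thesis by (rule covering_number_le_obtains) (intro exI conjI)
    qed
    then obtain T where T: "\<And>j. finite (T j)" "\<And>j. frontier \<Omega> \<inter> ball x (3 * R) \<subseteq> (\<Union>c\<in>T j. ball c (R / 2 ^ j))"
        "\<And>j. real (card (T j)) \<le> C0 * (3 * 2 ^ j) powr s"
      by metis
    define A where "A j = (\<Union>c\<in>T j. ball c (2 * (R / 2 ^ j)))" for j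
    have A_sets [measurable]: "A j \<in> sets borel" for j
      unfolding A_def by (intro borel_open open_UN) auto
    have layer: "ennreal (\<delta> z powr a) \<le> (\<Sum>j. ennreal ((R / 2 ^ Suc j) powr a) * indicator (A j) z)"
      if z: "z \<in> \<Omega>" "dist z w < K * \<delta> w" for z
    proof -
      have "0 < \<delta> z" using z \<delta>_pos by simp
      have "\<delta> z < R" using \<delta>_lipschitz[of z w] z by (simp add: R_def distrib_right)
      obtain n where "(1 / 2) ^ n < \<delta> z / R"
        using real_arch_pow_inv[of "\<delta> z / R" "1 / 2"] \<open>0 < \<delta> z\<close> \<open>0 < R\<close> by auto
      then have "R / 2 ^ n < \<delta> z" using \<open>0 < R\<close> by (simp add: field_simps power_divide)
      moreover have "\<not> R / 2 ^ 0 < \<delta> z" using \<open>\<delta> z < R\<close> by simp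
      \<comment> \<open>\<open>Suc j\<close> is the first index at which \<open>R / 2 ^ n\<close>
        falls below \<open>\<delta> z\<close>; it is not 0 because
        \<open>\<delta> z < R\<close>.\<close>
      ultimately obtain j where j: "\<delta> z \<le> R / 2 ^ j" "R / 2 ^ Suc j < \<delta> z"
        using ex_least_nat_less[of "\<lambda>n. R / 2 ^ n < \<delta> z" n] by (metis linorder_not_le order_refl)
      obtain y where y: "y \<in> frontier \<Omega>" "\<delta> z = dist z y"
        using infdist_attains_inf[OF frontier_closed frontier_nonempty] by (metis bdist_def)
      have "dist x y \<le> dist x w + dist w z + dist z y"
        using dist_triangle[of x y w] dist_triangle[of w y z] by linarith
      then have "dist x y < 3 * R"
      proof -
        have "dist w z < R - \<delta> w" using z by (simp add: R_def distrib_right dist_commute)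
        then show ?thesis
          using \<open>dist x y \<le> dist x w + dist w z + dist z y\<close> x y \<open>\<delta> z < R\<close> \<open>0 < R\<close>
          by (simp add: dist_commute)
      qed
      then obtain c where c: "c \<in> T j" "dist c y < R / 2 ^ j"
        using T(2)[of j] y by (auto simp: subset_iff)
      have "dist c z \<le> dist c y + dist z y" by (rule dist_triangle2)
      then have "dist c z < 2 * (R / 2 ^ j)" using c j y by linarith
      then have "z \<in> A j" using c by (auto simp: A_def)
      have "\<delta> z powr a \<le> (R / 2 ^ Suc j) powr a"
        using j \<open>0 < R\<close> \<open>a < 0\<close> by (intro powr_mono2') auto
      then have "ennreal (\<delta> z powr a) \<le> ennreal ((R / 2 ^ Suc j) powr a) * indicator (A j) z"
        using \<open>z \<in> A j\<close> by (simp add: ennreal_leI)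
      also have "\<dots> \<le> (\<Sum>j. ennreal ((R / 2 ^ Suc j) powr a) * indicator (A j) z)"
      proof -
        have "f j \<le> suminf f" for f :: "nat \<Rightarrow> ennreal"
          using sum_le_suminf[OF summableI, of "{j}" f] by simp
        then show ?thesis .
      qed
      finally show ?thesis .
    qed
    have term_le: "ennreal ((R / 2 ^ Suc j) powr a) * emeasure lborel (A j) \<le> ennreal (C1 * R powr (a + 2) * q ^ j)" for j
    proof -
      have "emeasure lborel (A j) \<le> ennreal (real (card (T j)) * (pi * (2 * (R / 2 ^ j))\<^sup>2))"
        unfolding A_def using T(1) \<open>0 < R\<close> by (intro emeasure_Union_balls_le) auto
      also have "\<dots> \<le> ennreal (C0 * (3 * 2 ^ j) powr s * (pi * (2 * (R / 2 ^ j))\<^sup>2))"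
        using T(3) by (intro ennreal_leI mult_right_mono) auto
      finally have "ennreal ((R / 2 ^ Suc j) powr a) * emeasure lborel (A j)
          \<le> ennreal ((R / 2 ^ Suc j) powr a) * ennreal (C0 * (3 * 2 ^ j) powr s * (pi * (2 * (R / 2 ^ j))\<^sup>2))"
        by (rule mult_left_mono) simp
      also have "\<dots> = ennreal ((R / 2 ^ Suc j) powr a * (C0 * (3 * 2 ^ j) powr s * (pi * (2 * (R / 2 ^ j))\<^sup>2)))"
        using \<open>0 < C0\<close> by (simp flip: ennreal_mult)
      also have "(R / 2 ^ Suc j) powr a * (C0 * (3 * 2 ^ j) powr s * (pi * (2 * (R / 2 ^ j))\<^sup>2))
          = C1 * R powr (a + 2) * q ^ j"
      proof -
        \<comment> \<open>All powers of 2 become real powers, so that the exponents depending on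
          \<open>j\<close> can be collected into \<open>q ^ j\<close>.\<close>
        have p2: "2 ^ n = 2 powr real n" for n :: nat
          by (rule powr_realpow[symmetric]) simp
        have div: "R / 2 ^ n = R * 2 powr (- real n)" for n :: nat
          unfolding p2 by (simp only: powr_minus divide_inverse)
        have "- real (Suc j) * a = - a + - a * real j" by (simp add: algebra_simps)
        then have e1: "(R / 2 ^ Suc j) powr a = R powr a * (2 powr (- a) * 2 powr (- a * real j))"
          unfolding div powr_mult powr_powr by (simp only: powr_add)
        have e2: "(3 * 2 ^ j) powr s = 3 powr s * 2 powr (s * real j)"
          unfolding p2 powr_mult powr_powr by (simp only: mult.commute)
        have "(2 * (R / 2 ^ j))\<^sup>2 = (2 * (R / 2 ^ j)) powr 2"
          using \<open>0 < R\<close> by simp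
        then have e3: "(2 * (R / 2 ^ j))\<^sup>2 = 4 * (R powr 2 * 2 powr (- real j * 2))"
          unfolding div powr_mult powr_powr by simp
        have "q ^ j = q powr real j" using q by (simp add: powr_realpow)
        also have "\<dots> = 2 powr (s * real j + (- a * real j + - real j * 2))"
          unfolding q_def powr_powr by (simp add: algebra_simps)
        finally have e4: "q ^ j = 2 powr (s * real j) * (2 powr (- a * real j) * 2 powr (- real j * 2))"
          by (simp only: powr_add)
        show ?thesis
          unfolding e1 e2 e3 e4 C1_def powr_add by (simp only: mult_ac)
      qed
      finally show ?thesis .
    qed
    have "(\<integral>\<^sup>+z\<in>{z\<in>\<Omega>. dist z w < K * \<delta> w}. ennreal (\<delta> z powr a) \<partial>lborel)
      \<le> (\<integral>\<^sup>+z. (\<Sum>j. ennreal ((R / 2 ^ Suc j) powr a) * indicator (A j) z) \<partial>lborel)"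
      using layer by (intro nn_integral_mono) (auto simp: indicator_def)
    also have "\<dots> = (\<Sum>j. \<integral>\<^sup>+z. ennreal ((R / 2 ^ Suc j) powr a) * indicator (A j) z \<partial>lborel)"
      by (rule nn_integral_suminf) measurable
    also have "\<dots> = (\<Sum>j. ennreal ((R / 2 ^ Suc j) powr a) * emeasure lborel (A j))"
      by (simp add: nn_integral_cmult_indicator)
    also have "\<dots> \<le> (\<Sum>j. ennreal (C1 * R powr (a + 2) * q ^ j))"
      using term_le by (intro suminf_le summableI)
    also have "\<dots> = ennreal (C1 * R powr (a + 2) * (1 / (1 - q)))"
      using q \<open>0 \<le> C1\<close>
      by (intro sums_unique[symmetric] sums_ennreal[THEN iffD2] sums_mult geometric_sums) auto
    also have "C1 * R powr (a + 2) * (1 / (1 - q)) = C * \<delta> w powr (a + 2)"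
      by (simp add: C_def R_def powr_mult)
    finally show ?thesis .
  qed
  moreover have "0 \<le> C" using \<open>0 \<le> C1\<close> q by (simp add: C_def)
  ultimately show "\<exists>C\<ge>0. \<forall>w\<in>\<Omega>.
     (\<integral>\<^sup>+z\<in>{z\<in>\<Omega>. dist z w < K * \<delta> w}. ennreal (\<delta> z powr a) \<partial>lborel) \<le> ennreal (C * \<delta> w powr (a + 2))"
    by blast
qed

end

subsection \<open>The comparison on John domains\<close>

text \<open>Everything is applied to the derivative of order \<open>m\<close>, with weight exponent
  \<open>real m * p - 2\<close>. The Poincare estimate and the change of base point give the lower
  bound; the point bound and the derivative bound give the upper one.\<close>

lemma john_domain_order_comparison:
  assumes "john_domain \<Omega>" "1 \<le> p" and shadow: "bounded_open_set.shadow_condition \<Omega> (real m * p - 2)"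
  shows "order_comparison \<Omega> p m"
  unfolding order_comparison_def
proof
  interpret bounded_open_set \<Omega>
    using assms(1) by unfold_locales (auto simp: john_domain_def)
  define a where "a = real m * p - 2"
  fix z0 assume z0: "z0 \<in> \<Omega>"
  obtain x0 c where x0: "x0 \<in> \<Omega>" and "0 < c" and
    john: "\<And>x. x \<in> \<Omega> \<Longrightarrow> \<exists>\<gamma> l. arclength_curve \<gamma> l \<and> \<gamma> ` {0..l} \<subseteq> \<Omega> \<and> \<gamma> 0 = x \<and> \<gamma> l = x0 \<and>
        (\<forall>t\<in>{0..l}. c * t \<le> \<delta> (\<gamma> t))"
    using assms(1) unfolding john_domain_def by metis
  have john': "\<exists>\<gamma> l. 0 \<le> l \<and> (\<forall>s t. dist (\<gamma> s) (\<gamma> t) \<le> \<bar>s - t\<bar>) \<and>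
        (\<forall>t. \<gamma> t \<in> \<Omega>) \<and> \<gamma> 0 = z \<and> \<gamma> l = x0 \<and> (\<forall>t. 0 \<le> t \<longrightarrow> t \<le> l \<longrightarrow> c * t \<le> \<delta> (\<gamma> t))"
    if z: "z \<in> \<Omega>" for z
  proof -
    obtain \<gamma> l where \<gamma>: "arclength_curve \<gamma> l" "\<gamma> ` {0..l} \<subseteq> \<Omega>" "\<gamma> 0 = z" "\<gamma> l = x0"
        "\<forall>t\<in>{0..l}. c * t \<le> \<delta> (\<gamma> t)"
      using john[OF z] by blast
    have "0 \<le> l" using \<gamma>(1) by (simp add: arclength_curve_def)
    \<comment> \<open>The curve is continued by constants beyond both ends, which preserves the
      Lipschitz bound.\<close>
    define \<beta> where "\<beta> t = \<gamma> (max 0 (min l t))" for t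
    have le: "dist (\<beta> s) (\<beta> t) \<le> \<bar>s - t\<bar>" if "s \<le> t" for s t
    proof -
      have "dist (\<beta> s) (\<beta> t) \<le> max 0 (min l t) - max 0 (min l s)"
        unfolding \<beta>_def using \<gamma>(1) \<open>0 \<le> l\<close> that by (intro arclength_curve_lipschitz) auto
      also have "\<dots> \<le> \<bar>s - t\<bar>" using that by auto
      finally show ?thesis .
    qed
    have "dist (\<beta> s) (\<beta> t) \<le> \<bar>s - t\<bar>" for s t
      using le[of s t] le[of t s] by (cases "s \<le> t") (auto simp: dist_commute)
    moreover have "\<beta> t \<in> \<Omega>" for t
      unfolding \<beta>_def using \<gamma>(2) \<open>0 \<le> l\<close> by (auto simp: image_subset_iff)
    moreover have "\<beta> 0 = z" "\<beta> l = x0" "\<And>t. 0 \<le> t \<Longrightarrow> t \<le> l \<Longrightarrow> c * t \<le> \<delta> (\<beta> t)"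
      using \<gamma> \<open>0 \<le> l\<close> by (auto simp: \<beta>_def min_def max_def)
    ultimately show ?thesis using \<open>0 \<le> l\<close> by blast
  qed
  have shadow': "shadow_condition a" using shadow by (simp add: a_def)
  obtain C1 where C1: "0 \<le> C1" "\<And>g. g holomorphic_on \<Omega> \<Longrightarrow>
     weighted_norm a p g \<le> ennreal C1 * (ennreal (norm (g x0) powr p) + weighted_norm (a + p) p (deriv g))"
    using weighted_poincare[OF \<open>0 < c\<close> john' shadow' \<open>1 \<le> p\<close>] by blast
  have "connected \<Omega>" using assms(1) by (simp add: john_domain_def)
  then obtain C2 where C2: "1 \<le> C2" "\<And>g. g holomorphic_on \<Omega> \<Longrightarrow>
      ennreal (norm (g x0) powr p) \<le> ennreal C2 * (ennreal (norm (g z0) powr p) + weighted_norm (a + p) p (deriv g))"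
    using center_change[OF _ \<open>1 \<le> p\<close> x0 z0] by blast
  obtain C3 where C3: "0 \<le> C3" "\<And>g. g holomorphic_on \<Omega> \<Longrightarrow> ennreal (norm (g z0) powr p) \<le> ennreal C3 * weighted_norm a p g"
    using point_bound[OF \<open>1 \<le> p\<close> z0] by blast
  obtain C4 where C4: "0 \<le> C4" "\<And>g. g holomorphic_on \<Omega> \<Longrightarrow> weighted_norm (a + p) p (deriv g) \<le> ennreal C4 * weighted_norm a p g"
    using derivative_bound[OF shadow' \<open>1 \<le> p\<close>] by blast
  define d where "d = \<delta> z0 powr (real m * p)"
  have "0 < d" using \<delta>_pos[OF z0] by (simp add: d_def)
  \<comment> \<open>The middle term carries the factor \<open>d\<close> on the point value;
    \<open>k\<close> compensates it when \<open>d\<close> is less than 1.\<close>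
  define k where "k = max 1 (1 / d)"
  have "1 \<le> k" "1 \<le> k * d" using \<open>0 < d\<close> by (auto simp: k_def max_def field_simps)
  define L where "L = C1 * (C2 + 1) * k"
  define U where "U = C3 * d + C4"
  define C where "C = max 1 (max L U)"
  have "0 \<le> L" "0 \<le> U" using C1 C2 C3 C4 \<open>1 \<le> k\<close> \<open>0 < d\<close> by (auto simp: L_def U_def)
  have "1 \<le> C" "L \<le> C" "U \<le> C" by (auto simp: C_def)
  show "\<exists>C\<ge>1. \<forall>f. f analytic_on \<Omega> \<longrightarrow>
        (let M = ennreal (norm ((deriv ^^ m) f z0) powr p * \<delta> z0 powr (real m * p))
                 + weighted_integral \<Omega> p (m + 1) f
         in ennreal (inverse C) * weighted_integral \<Omega> p m f \<le> M \<and>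
            M \<le> ennreal C * weighted_integral \<Omega> p m f)"
  proof (intro exI conjI allI impI)
    show "1 \<le> C" by fact
    fix f assume "f analytic_on \<Omega>"
    then have "f holomorphic_on \<Omega>" by (rule analytic_imp_holomorphic)
    define g where "g = (deriv ^^ m) f"
    have g: "g holomorphic_on \<Omega>"
      unfolding g_def using \<open>f holomorphic_on \<Omega>\<close> open_\<Omega> by (rule holomorphic_higher_deriv)
    define W where "W = weighted_norm a p g"
    define Y where "Y = weighted_norm (a + p) p (deriv g)"
    define P where "P = ennreal (norm (g z0) powr p)"
    have W_eq: "weighted_integral \<Omega> p m f = W"
      by (simp add: weighted_integral_def W_def weighted_norm_def g_def a_def)
    \<comment> \<open>One more derivative raises the weight exponent by exactly \<open>p\<close>,
      which identifies \<open>Y\<close> with the integral of order \<open>m + 1\<close>.\<close>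
    have "real (m + 1) * p - 2 = a + p" by (simp add: a_def algebra_simps)
    then have Y_eq: "weighted_integral \<Omega> p (m + 1) f = Y"
      by (simp only: weighted_integral_def Y_def weighted_norm_def g_def) simp
    have P_eq: "ennreal (norm ((deriv ^^ m) f z0) powr p * \<delta> z0 powr (real m * p)) = ennreal d * P"
      using \<open>0 < d\<close> by (simp add: P_def g_def d_def ennreal_mult mult.commute)
    have "W \<le> ennreal C1 * (ennreal C2 * (P + Y) + ennreal 1 * (P + Y))"
    proof -
      have "W \<le> ennreal C1 * (ennreal (norm (g x0) powr p) + Y)" unfolding W_def Y_def by (rule C1(2)[OF g])
      also have "\<dots> \<le> ennreal C1 * (ennreal C2 * (P + Y) + ennreal 1 * (P + Y))"
        using C2(2)[OF g] by (intro mult_left_mono add_mono) (auto simp: P_def Y_def)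
      finally show ?thesis .
    qed
    also have "\<dots> = ennreal (C1 * (C2 + 1)) * (P + Y)"
      using C1(1) C2(1) by (simp add: ennreal_mult distrib_right distrib_left mult.assoc)
    also have "\<dots> \<le> ennreal (C1 * (C2 + 1)) * (ennreal (k * d) * P + ennreal k * Y)"
    proof (intro mult_left_mono add_mono)
      show "P \<le> ennreal (k * d) * P"
        using mult_right_mono[of 1 "ennreal (k * d)" P] \<open>1 \<le> k * d\<close> by simp
      show "Y \<le> ennreal k * Y"
        using mult_right_mono[of 1 "ennreal k" Y] \<open>1 \<le> k\<close> by simp
    qed simp
    also have "\<dots> = ennreal L * (ennreal d * P + Y)"
    proof -
      have e: "ennreal L = ennreal (C1 * (C2 + 1)) * ennreal k" "ennreal (k * d) = ennreal k * ennreal d"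
        unfolding L_def using C1(1) C2(1) \<open>1 \<le> k\<close> \<open>0 < d\<close> by (auto intro!: ennreal_mult)
      show ?thesis unfolding e by (simp only: distrib_left mult.assoc)
    qed
    also have "\<dots> \<le> ennreal C * (ennreal d * P + Y)"
      using \<open>L \<le> C\<close> by (intro mult_right_mono ennreal_leI) auto
    finally have "ennreal (inverse C) * W \<le> ennreal (inverse C) * (ennreal C * (ennreal d * P + Y))"
      by (rule mult_left_mono) simp
    also have "\<dots> = (ennreal (inverse C) * ennreal C) * (ennreal d * P + Y)"
      by (simp only: mult.assoc)
    also have "ennreal (inverse C) * ennreal C = 1"
      using \<open>1 \<le> C\<close> by (simp flip: ennreal_mult)
    finally have lower: "ennreal (inverse C) * W \<le> ennreal d * P + Y" by simp
    have "ennreal d * P + Y \<le> ennreal d * (ennreal C3 * W) + ennreal C4 * W"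
      unfolding P_def Y_def W_def using C3(2)[OF g] C4(2)[OF g] by (intro add_mono mult_left_mono) auto
    also have "\<dots> = ennreal U * W"
      using C3(1) C4(1) \<open>0 < d\<close> by (simp add: U_def ennreal_mult distrib_right distrib_left mult_ac)
    also have "\<dots> \<le> ennreal C * W"
      using \<open>U \<le> C\<close> by (intro mult_right_mono ennreal_leI) auto
    finally have "ennreal d * P + Y \<le> ennreal C * W" .
    with lower show "let M = ennreal (norm ((deriv ^^ m) f z0) powr p * \<delta> z0 powr (real m * p))
                 + weighted_integral \<Omega> p (m + 1) f
         in ennreal (inverse C) * weighted_integral \<Omega> p m f \<le> M \<and>
            M \<le> ennreal C * weighted_integral \<Omega> p m f"
      unfolding W_eq Y_eq P_eq Let_def by blast
  qed
qed

theorem corollary1p3: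
  fixes \<Omega> :: "complex set" and p :: real
  assumes "john_domain \<Omega>" and "1 < p"
  shows "(\<forall>m\<ge>2. order_comparison \<Omega> p m) \<and>
         (2 \<le> p \<longrightarrow> order_comparison \<Omega> p 1) \<and>
         (p < 2 \<and> assouad_dim (frontier \<Omega>) < ereal p \<longrightarrow> order_comparison \<Omega> p 1)"
proof -
  interpret bounded_open_set \<Omega>
    using assms(1) by unfold_locales (auto simp: john_domain_def)
  note comparison = john_domain_order_comparison[OF assms(1) less_imp_le[OF assms(2)]]
  show ?thesis
  proof (intro conjI allI impI)
    fix m :: nat assume "2 \<le> m"
    \<comment> \<open>The weight exponent \<open>real m * p - 2\<close> is thus nonnegative, so no
      information on the frontier is required.\<close>
    then have "2 * 1 \<le> real m * p" using \<open>1 < p\<close> by (intro mult_mono) auto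
    then show "order_comparison \<Omega> p m" by (intro comparison shadow_condition_nonneg) simp
  next
    assume "2 \<le> p"
    then show "order_comparison \<Omega> p 1" by (intro comparison shadow_condition_nonneg) simp
  next
    assume *: "p < 2 \<and> assouad_dim (frontier \<Omega>) < ereal p"
    \<comment> \<open>An infimum below \<open>p\<close> yields an admissible exponent
      \<open>s\<close> below \<open>p\<close>, that is, below \<open>a + 2\<close> for
      \<open>a = p - 2\<close>.\<close>
    then obtain s C where "s < p" "0 < C" and
      "\<forall>x\<in>frontier \<Omega>. \<forall>R r. 0 < r \<and> r < R \<longrightarrow>
          ereal_of_enat (covering_number r (frontier \<Omega> \<inter> ball x R)) \<le> ereal (C * (R / r) powr s)"
      unfolding assouad_dim_def Inf_less_iff by auto
    then have "shadow_condition (p - 2)"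
      using * by (intro shadow_condition_neg[of "p - 2" s C]) auto
    then show "order_comparison \<Omega> p 1" by (intro comparison) simp
  qed
qed

end
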